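(* (1) $E_0$ is not infinite time computably reducible to the equality relation $=$ on $\mathbb{R}$. (2) $E_{\mathrm{set}}$ is not infinite time computably reducible to $E_0$. (3) Neither $\cong_{\mathrm{HC}}$ nor $E_{\mathrm{set}}$ is infinite time computably reducible to $\cong_{\mathrm{WO}}$.
   Context: $\mathbb{R}=2^\omega$. Infinite time Turing machines: Turing machines with three binary $\omega$-tapes run in transfinite ordinal time, with a special limit state at limit stages, head reset to the first cell, cells taking the $\limsup$ of earlier values. A function is infinite time computable if computed by such a machine, possibly with a fixed real parameter. For equivalence relations $E$ on $X\subseteq\mathbb{R}$, $F$ on $Y\subseteq\mathbb{R}$, $E\le_c F$ means there is an infinite time computable $f:X\to Y$ with $x\,E\,x'\iff f(x)\,F\,f(x')$. $x\,E_0\,y$ iff $x(n)=y(n)$ for all but finitely many $n$. A real $x$ codes a countable sequence of reals $(x)_n$ (via a fixed recursive pairing), and $x\,E_{\mathrm{set}}\,y$ iff $\{(x)_n:n\in\omega\}=\{(y)_n:n\in\omega\}$. A real codes a binary relation on $\omega$ via bit $\langle n,m\rangle$; $\mathrm{WO}$ is the set of codes of well-orders and $\cong_{\mathrm{WO}}$ is isomorphism on $\mathrm{WO}$; $\cong_{\mathrm{HC}}$ is isomorphism restricted to the set of reals coding hereditarily countable sets (codes of well-founded extensional relations on $\omega$, representing the transitive closure of a set). *)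

theory Defs
  imports Main "HOL-Library.Nat_Bijection"
begin

type_synonym cantor = "nat \<Rightarrow> bool"

record config =
  st  :: nat
  hd  :: nat
  inp :: "nat \<Rightarrow> bool"
  scr :: "nat \<Rightarrow> bool"
  out :: "nat \<Rightarrow> bool"

text \<open>A program: finitely many states 0..<nst, with 0 the start state, 1 the halt
  state, 2 the limit state.  The transition function reads the three bits under
  the head and returns (new state, bit written on tape 1, tape 2, tape 3,
  move right? ).\<close>
record prog =
  nst   :: nat
  delta :: "nat \<Rightarrow> bool \<Rightarrow> bool \<Rightarrow> bool \<Rightarrow> nat \<times> bool \<times> bool \<times> bool \<times> bool"

definition start_state :: nat where "start_state = 0"
definition halt_state :: nat where "halt_state = 1"
definition limit_state :: nat where "limit_state = 2"

definition valid_prog :: "prog \<Rightarrow> bool" where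
  "valid_prog P \<longleftrightarrow> 3 \<le> nst P \<and>
     (\<forall>q < nst P. \<forall>a b c. fst (delta P q a b c) < nst P)"

definition init_config :: "cantor \<Rightarrow> config" where
  "init_config w = \<lparr>st = start_state, hd = 0, inp = w, scr = (\<lambda>_. False), out = (\<lambda>_. False)\<rparr>"

text \<open>One computation step; moving left from cell 0 leaves the head on cell 0
  (natural-number subtraction).\<close>
definition step :: "prog \<Rightarrow> config \<Rightarrow> config" where
  "step P c = (let h = hd c;
                   (q', w1, w2, w3, mv) = delta P (st c) (inp c h) (scr c h) (out c h)
               in \<lparr>st = q', hd = (if mv then h + 1 else h - 1),
                   inp = (inp c)(h := w1), scr = (scr c)(h := w2), out = (out c)(h := w3)\<rparr>)"

definition lt_in :: "'t rel \<Rightarrow> 't \<Rightarrow> 't \<Rightarrow> bool" where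
  "lt_in r s t \<longleftrightarrow> (s, t) \<in> r \<and> s \<noteq> t"

definition is_least_in :: "'t rel \<Rightarrow> 't \<Rightarrow> bool" where
  "is_least_in r t \<longleftrightarrow> (\<forall>s\<in>Field r. (t, s) \<in> r)"

definition immediate_pred :: "'t rel \<Rightarrow> 't \<Rightarrow> 't \<Rightarrow> bool" where
  "immediate_pred r s t \<longleftrightarrow> s \<in> Field r \<and> lt_in r s t \<and>
     \<not> (\<exists>u\<in>Field r. lt_in r s u \<and> lt_in r u t)"

definition is_limit_in :: "'t rel \<Rightarrow> 't \<Rightarrow> bool" where
  "is_limit_in r t \<longleftrightarrow> \<not> is_least_in r t \<and> \<not> (\<exists>s. immediate_pred r s t)"

definition limsup_before :: "'t rel \<Rightarrow> 't \<Rightarrow> ('t \<Rightarrow> bool) \<Rightarrow> bool" where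
  "limsup_before r t f \<longleftrightarrow>
     (\<forall>s\<in>Field r. lt_in r s t \<longrightarrow> (\<exists>u\<in>Field r. (s, u) \<in> r \<and> lt_in r u t \<and> f u))"

definition limit_config :: "'t rel \<Rightarrow> 't \<Rightarrow> ('t \<Rightarrow> config) \<Rightarrow> config" where
  "limit_config r t c = \<lparr>st = limit_state, hd = 0,
      inp = (\<lambda>i. limsup_before r t (\<lambda>u. inp (c u) i)),
      scr = (\<lambda>i. limsup_before r t (\<lambda>u. scr (c u) i)),
      out = (\<lambda>i. limsup_before r t (\<lambda>u. out (c u) i))\<rparr>"

definition ittm_run :: "'t rel \<Rightarrow> ('t \<Rightarrow> config) \<Rightarrow> prog \<Rightarrow> cantor \<Rightarrow> bool" where
  "ittm_run r c P w \<longleftrightarrow> Well_order r \<and>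
     (\<forall>t\<in>Field r.
        (is_least_in r t \<longrightarrow> c t = init_config w) \<and>
        (\<forall>s. immediate_pred r s t \<longrightarrow> c t = step P (c s)) \<and>
        (is_limit_in r t \<longrightarrow> c t = limit_config r t c)) \<and>
     (\<forall>s\<in>Field r. st (c s) = halt_state \<longrightarrow> (\<forall>t\<in>Field r. (t, s) \<in> r))"

text \<open>P on input w halts with output y.  Times are indexed by well-orders on
  the type nat set, which has the size of the continuum and hence accommodates
  every countable ordinal (all ITTM halting times are countable).\<close>
definition halts_with :: "prog \<Rightarrow> cantor \<Rightarrow> cantor \<Rightarrow> bool" where
  "halts_with P w y \<longleftrightarrow>
     (\<exists>(r :: nat set rel) c m. ittm_run r c P w \<and> m \<in> Field r \<and>
        (\<forall>s\<in>Field r. (s, m) \<in> r) \<and> st (c m) = halt_state \<and> out (c m) = y)"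

definition join :: "cantor \<Rightarrow> cantor \<Rightarrow> cantor" where
  "join x z n = (if even n then x (n div 2) else z (n div 2))"

definition itt_computable_on :: "cantor set \<Rightarrow> (cantor \<Rightarrow> cantor) \<Rightarrow> bool" where
  "itt_computable_on X f \<longleftrightarrow>
     (\<exists>P z. valid_prog P \<and> (\<forall>x\<in>X. halts_with P (join x z) (f x)))"

definition itt_reducible ::
  "(cantor \<Rightarrow> cantor \<Rightarrow> bool) \<Rightarrow> cantor set \<Rightarrow> (cantor \<Rightarrow> cantor \<Rightarrow> bool) \<Rightarrow> cantor set \<Rightarrow> bool" where
  "itt_reducible E X F Y \<longleftrightarrow>
     (\<exists>f. (\<forall>x\<in>X. f x \<in> Y) \<and> itt_computable_on X f \<and>
          (\<forall>x\<in>X. \<forall>x'\<in>X. E x x' \<longleftrightarrow> F (f x) (f x')))"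

definition E0 :: "cantor \<Rightarrow> cantor \<Rightarrow> bool" where
  "E0 x y \<longleftrightarrow> finite {n. x n \<noteq> y n}"

definition seq_entry :: "cantor \<Rightarrow> nat \<Rightarrow> cantor" where
  "seq_entry x n = (\<lambda>m. x (prod_encode (n, m)))"

definition Eset :: "cantor \<Rightarrow> cantor \<Rightarrow> bool" where
  "Eset x y \<longleftrightarrow> range (seq_entry x) = range (seq_entry y)"

definition coded_rel :: "cantor \<Rightarrow> nat rel" where
  "coded_rel x = {(n, m). x (prod_encode (n, m))}"

definition WO :: "cantor set" where
  "WO = {x. Well_order (coded_rel x)}"

definition iso_WO :: "cantor \<Rightarrow> cantor \<Rightarrow> bool" where
  "iso_WO x y \<longleftrightarrow> (coded_rel x, coded_rel y) \<in> ordIso"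

definition HC :: "cantor set" where
  "HC = {x. wf (coded_rel x) \<and>
            (\<forall>n m. (\<forall>k. (k, n) \<in> coded_rel x \<longleftrightarrow> (k, m) \<in> coded_rel x) \<longrightarrow> n = m)}"

definition iso_HC :: "cantor \<Rightarrow> cantor \<Rightarrow> bool" where
  "iso_HC x y \<longleftrightarrow> (\<exists>f. bij f \<and>
      (\<forall>n m. (n, m) \<in> coded_rel x \<longleftrightarrow> (f n, f m) \<in> coded_rel y))"

end

theory Submission
  imports Defs "HOL-Analysis.Analysis"
begin

text \<open>
  Everything rests on Baire category.  Let the input of an infinite time Turing machine depend on a
  parameter \<open>w\<close> of a second countable space, each input bit having the Baire property as a set of
  parameters.  Then so has every cell at every countable stage.  By the countable chain condition
  there are countable limit stages \<open>g\<close> that absorb the later ones: a cell that is 1 at a later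
  countable stage is, for comeagerly many \<open>w\<close>, already 1 at \<open>g\<close>.  Modulo meager sets the
  configurations at such stages can only shrink, so by the same condition they eventually agree: all
  generic runs that have not halted by some fixed countable stage repeat a loop.  Hence the output
  bits of a machine that always halts have the Baire property too.

  (1) By the topological zero-one law, an \<open>E0\<close>-invariant function whose bits have the Baire property
  is constant on a comeager set, but \<open>E0\<close>-classes are countable.

  (2) Present the set of reals \<open>a i\<close> by the enumeration \<open>a \<circ> h\<close> along a generic surjection \<open>h\<close>.  For
  fixed \<open>a\<close> the values of the reduction lie in one countable \<open>E0\<close>-class, so they are constant for
  generic \<open>h\<close> in some cylinder.  The cylinder mentions only finitely many indices, and permuting the
  other entries of \<open>a\<close> does not affect that constant; by a zero-one law for permutations it does not
  depend on them at all.  But the set determines its members.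

  (3) Already equality does not reduce to isomorphism of well-orders: for generic \<open>w\<close> the ranks in the
  well-order assigned to \<open>w\<close> are bounded by one countable ordinal, so countably many isomorphism
  types, each attained at most once, would cover a comeager set of reals.
\<close>

section \<open>Baire category\<close>

definition comeager :: "'a::topological_space filter" where
  "comeager = Abs_filter (\<lambda>Q.
     \<exists>G. countable G \<and> (\<forall>U\<in>G. open U \<and> closure U = UNIV) \<and> (\<forall>x. (\<forall>U\<in>G. x \<in> U) \<longrightarrow> Q x))"

lemma eventually_comeager:
  "eventually Q comeager \<longleftrightarrow>
     (\<exists>G. countable G \<and> (\<forall>U\<in>G. open U \<and> closure U = UNIV) \<and> (\<forall>x. (\<forall>U\<in>G. x \<in> U) \<longrightarrow> Q x))"
  unfolding comeager_def
proof (rule eventually_Abs_filter, unfold_locales)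
  show "\<exists>G. countable G \<and> (\<forall>U\<in>G. open U \<and> closure U = UNIV) \<and> (\<forall>x. (\<forall>U\<in>G. x \<in> U) \<longrightarrow> True)"
    by (intro exI[of _ "{}"]) simp
next
  fix Q R :: "'a \<Rightarrow> bool"
  assume "\<exists>G. countable G \<and> (\<forall>U\<in>G. open U \<and> closure U = UNIV) \<and> (\<forall>x. (\<forall>U\<in>G. x \<in> U) \<longrightarrow> Q x)"
  then obtain G where G: "countable G" "\<forall>U\<in>G. open U \<and> closure U = UNIV" "\<forall>x. (\<forall>U\<in>G. x \<in> U) \<longrightarrow> Q x"
    by blast
  assume "\<exists>G. countable G \<and> (\<forall>U\<in>G. open U \<and> closure U = UNIV) \<and> (\<forall>x. (\<forall>U\<in>G. x \<in> U) \<longrightarrow> R x)"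
  then obtain H where H: "countable H" "\<forall>U\<in>H. open U \<and> closure U = UNIV" "\<forall>x. (\<forall>U\<in>H. x \<in> U) \<longrightarrow> R x"
    by blast
  show "\<exists>G. countable G \<and> (\<forall>U\<in>G. open U \<and> closure U = UNIV) \<and> (\<forall>x. (\<forall>U\<in>G. x \<in> U) \<longrightarrow> Q x \<and> R x)"
    using G H by (intro exI[of _ "G \<union> H"]) (simp add: ball_Un)
next
  fix Q R :: "'a \<Rightarrow> bool"
  assume "\<forall>x. Q x \<longrightarrow> R x"
    and "\<exists>G. countable G \<and> (\<forall>U\<in>G. open U \<and> closure U = UNIV) \<and> (\<forall>x. (\<forall>U\<in>G. x \<in> U) \<longrightarrow> Q x)"
  then show "\<exists>G. countable G \<and> (\<forall>U\<in>G. open U \<and> closure U = UNIV) \<and> (\<forall>x. (\<forall>U\<in>G. x \<in> U) \<longrightarrow> R x)"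
    by metis
qed

lemma eventually_comeager_open_dense:
  assumes "open U" and "\<And>W. open W \<Longrightarrow> W \<noteq> {} \<Longrightarrow> \<exists>x\<in>W. x \<in> U"
  shows "\<forall>\<^sub>F x in comeager. x \<in> U"
proof -
  have "closure U = UNIV"
    using assms(2)[of "- closure U"] closure_subset[of U] by auto
  then show ?thesis
    unfolding eventually_comeager using assms(1) by (intro exI[of _ "{U}"]) simp
qed

lemma eventually_comeager_ball:
  assumes "countable I" and "\<And>i. i \<in> I \<Longrightarrow> \<forall>\<^sub>F x in comeager. Q i x"
  shows "\<forall>\<^sub>F x in comeager. \<forall>i\<in>I. Q i x"
proof -
  obtain G where G: "\<forall>i\<in>I. countable (G i) \<and> (\<forall>U\<in>G i. open U \<and> closure U = UNIV) \<and>
      (\<forall>x. (\<forall>U\<in>G i. x \<in> U) \<longrightarrow> Q i x)"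
    using assms(2) unfolding eventually_comeager by metis
  show ?thesis
    unfolding eventually_comeager using G assms(1) by (intro exI[of _ "\<Union>i\<in>I. G i"]) auto
qed

lemma eventually_comeager_all:
  fixes Q :: "'i::countable \<Rightarrow> 'a::topological_space \<Rightarrow> bool"
  assumes "\<And>i. \<forall>\<^sub>F x in comeager. Q i x"
  shows "\<forall>\<^sub>F x in comeager. \<forall>i. Q i x"
  using eventually_comeager_ball[of UNIV Q] assms by simp

lemma eventually_comeager_open_or_exterior:
  assumes "open U" shows "\<forall>\<^sub>F x in comeager. x \<in> U \<or> x \<in> interior (- U)"
proof -
  have "\<exists>x\<in>W. x \<in> U \<union> interior (- U)" if "open W" "W \<noteq> {}" for W
  proof (cases "W \<inter> U = {}")
    case True
    then have "W \<subseteq> interior (- U)"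
      using that by (intro interior_maximal) auto
    then show ?thesis
      using that by blast
  qed blast
  then show ?thesis
    using eventually_comeager_open_dense[of "U \<union> interior (- U)"] assms by (simp add: open_Un)
qed

lemma filterlim_comeager_open_map:
  assumes "continuous_on UNIV f" and "\<And>W. open W \<Longrightarrow> open (f ` W)"
  shows "filterlim f comeager comeager"
  unfolding filterlim_iff
proof (intro allI impI)
  fix Q :: "'b \<Rightarrow> bool" assume "eventually Q comeager"
  then obtain G where G: "countable G" "\<forall>U\<in>G. open U \<and> closure U = UNIV"
    "\<forall>x. (\<forall>U\<in>G. x \<in> U) \<longrightarrow> Q x"
    unfolding eventually_comeager by blast
  have "\<forall>\<^sub>F x in comeager. x \<in> f -` U" if U: "U \<in> G" for U
  proof (rule eventually_comeager_open_dense)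
    show "open (f -` U)"
      using G(2) U assms(1) by (auto intro: open_vimage)
    fix W :: "'a set" assume "open W" "W \<noteq> {}"
    then have "f ` W \<inter> U \<noteq> {}"
      using open_Int_closure_eq_empty[of "f ` W" U] assms(2) G(2) U by auto
    then show "\<exists>x\<in>W. x \<in> f -` U"
      by blast
  qed
  then have "\<forall>\<^sub>F x in comeager. \<forall>U\<in>G. x \<in> f -` U"
    by (rule eventually_comeager_ball[OF G(1)])
  then show "\<forall>\<^sub>F x in comeager. Q (f x)"
    by eventually_elim (use G(3) in blast)
qed

lemma filterlim_comeager_involution:
  assumes "continuous_on UNIV f" and "\<And>x. f (f x) = x"
  shows "filterlim f comeager comeager"
proof (rule filterlim_comeager_open_map[OF assms(1)])
  fix W :: "'a set" assume "open W"
  moreover have "x \<in> f ` W \<longleftrightarrow> x \<in> f -` W" for x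
    using assms(2) by (metis imageE imageI vimageD vimageI2)
  then have "f ` W = f -` W"
    by blast
  ultimately show "open (f ` W)"
    using assms(1) by (simp add: open_vimage)
qed

lemma filterlim_comeager_local_sections:
  assumes "continuous_on UNIV f" and "\<And>z. continuous_on UNIV (\<sigma> z)"
    and "\<And>z y. f (\<sigma> z y) = y" and "\<And>x. \<exists>z. \<sigma> z (f x) = x"
  shows "filterlim f comeager comeager"
proof (rule filterlim_comeager_open_map[OF assms(1)])
  fix W :: "'a set" assume W: "open W"
  have "f ` W = (\<Union>z. \<sigma> z -` W)"
  proof safe
    fix x assume "x \<in> W"
    moreover obtain z where "\<sigma> z (f x) = x"
      using assms(4) by blast
    ultimately have "f x \<in> \<sigma> z -` W"
      by simp
    then show "f x \<in> (\<Union>z. \<sigma> z -` W)"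
      by blast
  next
    fix z y assume "\<sigma> z y \<in> W"
    then show "y \<in> f ` W"
      using assms(3) by (metis image_eqI)
  qed
  then show "open (f ` W)"
    using W assms(2) by (simp add: open_UN open_vimage)
qed

subsection \<open>Polish spaces\<close>

class polish_topology = second_countable_topology +
  assumes completely_metrizable: "completely_metrizable_space (topology open)"

lemma completely_metrizable_space_euclidean_discrete:
  "completely_metrizable_space (euclidean :: 'a::discrete_topology topology)"
proof -
  have "euclidean = discrete_topology (UNIV :: 'a set)"
    using discrete_topology_unique[of "UNIV :: 'a set" euclidean] by (simp add: open_discrete)
  then show ?thesis
    by (simp add: completely_metrizable_space_discrete_topology)
qed

instance nat :: polish_topology
  by standard (rule completely_metrizable_space_euclidean_discrete)

instance bool :: polish_topology
proof
  show "\<exists>B::bool set set. countable B \<and> open = generate_topology B"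
    by (intro exI[of _ "range lessThan \<union> range greaterThan"]) (auto simp: open_bool_def)
qed (rule completely_metrizable_space_euclidean_discrete)

instance "fun" :: (countable, polish_topology) polish_topology
  by standard (subst euclidean_product_topology[symmetric],
    simp add: completely_metrizable_space_product_topology completely_metrizable)

lemma frequently_comeager_open:
  fixes U :: "'a::polish_topology set"
  assumes "open U" "U \<noteq> {}"
  shows "\<exists>\<^sub>F x in comeager. x \<in> U"
proof -
  have "\<not> (\<forall>x. (\<forall>V\<in>G. x \<in> V) \<longrightarrow> x \<notin> U)"
    if "countable G" "\<forall>V\<in>G. open V \<and> closure V = UNIV" for G
  proof -
    have "closure (\<Inter>G) = UNIV"
      using Baire_category[of "euclidean :: 'a topology" G] that by (simp add: completely_metrizable)
    then have "U \<inter> \<Inter>G \<noteq> {}"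
      using open_Int_closure_eq_empty[OF assms(1), of "\<Inter>G"] assms(2) by simp
    then show ?thesis
      by auto
  qed
  then show ?thesis
    unfolding frequently_def eventually_comeager by blast
qed

lemma comeager_neq_bot: "comeager \<noteq> (bot :: 'a::polish_topology filter)"
  using frequently_comeager_open[of "UNIV :: 'a set"] by (auto simp: frequently_def trivial_limit_def)

lemma ex_frequently_comeager:
  fixes Q :: "'i \<Rightarrow> 'a::polish_topology \<Rightarrow> bool"
  assumes "\<forall>\<^sub>F x in comeager. \<exists>i\<in>I. Q i x" and "countable I"
  shows "\<exists>i\<in>I. \<exists>\<^sub>F x in comeager. Q i x"
proof (rule ccontr)
  assume "\<not> ?thesis"
  then have "\<forall>\<^sub>F x in comeager. \<forall>i\<in>I. \<not> Q i x"
    using assms(2) by (intro eventually_comeager_ball) (auto simp: not_frequently)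
  then obtain x where "\<exists>i\<in>I. Q i x" "\<forall>i\<in>I. \<not> Q i x"
    using eventually_happens'[OF comeager_neq_bot eventually_conj[OF assms(1)]] by blast
  then show False
    by blast
qed

subsection \<open>The Baire property\<close>

definition baire_property :: "'a::topological_space set \<Rightarrow> bool" where
  "baire_property A \<longleftrightarrow> (\<exists>U. open U \<and> (\<forall>\<^sub>F x in comeager. x \<in> A \<longleftrightarrow> x \<in> U))"

lemma baire_property_Compl:
  assumes "baire_property A" shows "baire_property (- A)"
proof -
  obtain U where U: "open U" "\<forall>\<^sub>F x in comeager. x \<in> A \<longleftrightarrow> x \<in> U"
    using assms unfolding baire_property_def by blast
  have "\<forall>\<^sub>F x in comeager. x \<in> - A \<longleftrightarrow> x \<in> interior (- U)"
    using U(2) eventually_comeager_open_or_exterior[OF U(1)]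
    by eventually_elim (use interior_subset[of "- U"] in auto)
  then show ?thesis
    unfolding baire_property_def by blast
qed

lemma baire_property_UN:
  assumes "\<And>i::'i::countable. baire_property (A i)" shows "baire_property (\<Union>i. A i)"
proof -
  obtain U where U: "\<And>i. open (U i)" "\<And>i. \<forall>\<^sub>F x in comeager. x \<in> A i \<longleftrightarrow> x \<in> U i"
    using assms unfolding baire_property_def by metis
  have "\<forall>\<^sub>F x in comeager. x \<in> (\<Union>i. A i) \<longleftrightarrow> x \<in> (\<Union>i. U i)"
    using eventually_comeager_all[of "\<lambda>i x. x \<in> A i \<longleftrightarrow> x \<in> U i", OF U(2)] by eventually_elim simp
  then show ?thesis
    unfolding baire_property_def using U(1) by (intro exI[of _ "\<Union>i. U i"]) auto
qed

definition baire_algebra :: "'a::topological_space measure" where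
  "baire_algebra = sigma UNIV {A. baire_property A}"

lemma space_baire_algebra [simp]: "space baire_algebra = UNIV"
  by (simp add: baire_algebra_def)

lemma sets_baire_algebra: "sets baire_algebra = {A. baire_property A}"
proof -
  have "sigma_algebra (UNIV :: 'a set) {A. baire_property A}"
    unfolding sigma_algebra_iff2
    using baire_property_Compl baire_property_UN
    by (auto simp: Compl_eq_Diff_UNIV image_subset_iff baire_property_def intro: exI[of _ "{}"])
  then show ?thesis
    by (simp add: baire_algebra_def sigma_algebra.sigma_sets_eq)
qed

lemma pred_baire_algebra_iff:
  "Measurable.pred baire_algebra Q \<longleftrightarrow> (\<exists>U. open U \<and> (\<forall>\<^sub>F x in comeager. Q x \<longleftrightarrow> x \<in> U))"
  by (simp add: pred_def sets_baire_algebra baire_property_def)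

lemma pred_baire_algebra_cong:
  assumes "\<forall>\<^sub>F x in comeager. Q x \<longleftrightarrow> R x"
  shows "Measurable.pred baire_algebra Q \<longleftrightarrow> Measurable.pred baire_algebra R"
proof -
  have "(\<forall>\<^sub>F x in comeager. Q x \<longleftrightarrow> x \<in> U) \<longleftrightarrow> (\<forall>\<^sub>F x in comeager. R x \<longleftrightarrow> x \<in> U)" for U
    using assms by (intro eventually_subst) (auto elim: eventually_mono)
  then show ?thesis
    by (simp add: pred_baire_algebra_iff)
qed

lemma measurable_baire_algebra_continuous:
  fixes f :: "'a::topological_space \<Rightarrow> 'b::{discrete_topology, countable}"
  assumes "continuous_on UNIV f"
  shows "f \<in> baire_algebra \<rightarrow>\<^sub>M count_space UNIV"
proof -
  have "f -` {y} \<in> sets baire_algebra" for y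
    using open_vimage[OF open_discrete assms, of "{y}"]
    by (auto simp: sets_baire_algebra baire_property_def intro!: exI[of _ "f -` {y}"])
  then show ?thesis
    by (simp add: measurable_count_space_eq2_countable)
qed

lemma frequently_comeager_imp_localized:
  assumes "Measurable.pred baire_algebra Q" and "\<exists>\<^sub>F x in comeager. Q x"
  obtains U where "open U" "U \<noteq> {}" "\<forall>\<^sub>F x in comeager. x \<in> U \<longrightarrow> Q x"
proof -
  obtain U where U: "open U" "\<forall>\<^sub>F x in comeager. Q x \<longleftrightarrow> x \<in> U"
    using assms(1) by (auto simp: pred_baire_algebra_iff)
  have "U \<noteq> {}"
    using assms(2) U(2) by (auto simp: frequently_def)
  moreover have "\<forall>\<^sub>F x in comeager. x \<in> U \<longrightarrow> Q x"
    using U(2) by eventually_elim blast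
  ultimately show thesis
    using that U(1) by blast
qed

text \<open>The category algebra satisfies the countable chain condition.\<close>

lemma countable_essential_union:
  fixes Q :: "'i \<Rightarrow> 'a::second_countable_topology \<Rightarrow> bool"
  assumes "\<And>i. i \<in> I \<Longrightarrow> Measurable.pred baire_algebra (Q i)"
  shows "\<exists>J\<subseteq>I. countable J \<and> (\<forall>i\<in>I. \<forall>\<^sub>F x in comeager. Q i x \<longrightarrow> (\<exists>j\<in>J. Q j x))"
proof -
  obtain U where U: "\<And>i. i \<in> I \<Longrightarrow> open (U i)"
    "\<And>i. i \<in> I \<Longrightarrow> \<forall>\<^sub>F x in comeager. Q i x \<longleftrightarrow> x \<in> U i"
    using assms unfolding pred_baire_algebra_iff by metis
  obtain F where "F \<subseteq> U ` I" "countable F" "\<Union>F = \<Union>(U ` I)"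
    using Lindelof[of "U ` I"] U(1) by auto
  then obtain J where J: "J \<subseteq> I" "countable J" "(\<Union>j\<in>J. U j) = (\<Union>i\<in>I. U i)"
    by (metis countable_subset_image)
  have generic: "\<forall>\<^sub>F x in comeager. \<forall>j\<in>J. Q j x \<longleftrightarrow> x \<in> U j"
    using J(1,2) U(2) by (intro eventually_comeager_ball) auto
  have "\<forall>\<^sub>F x in comeager. Q i x \<longrightarrow> (\<exists>j\<in>J. Q j x)" if "i \<in> I" for i
    using generic U(2)[OF that] by eventually_elim (use J(3) that in blast)
  then show ?thesis
    using J(1,2) by blast
qed

lemma countable_essential_union_family:
  fixes Q :: "'k::countable \<Rightarrow> 'i \<Rightarrow> 'a::second_countable_topology \<Rightarrow> bool"
  assumes "\<And>k i. i \<in> I \<Longrightarrow> Measurable.pred baire_algebra (Q k i)"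
  shows "\<exists>J\<subseteq>I. countable J \<and> (\<forall>i\<in>I. \<forall>\<^sub>F x in comeager. \<forall>k. Q k i x \<longrightarrow> (\<exists>j\<in>J. Q k j x))"
proof -
  have "\<exists>J\<subseteq>I. countable J \<and> (\<forall>i\<in>I. \<forall>\<^sub>F x in comeager. Q k i x \<longrightarrow> (\<exists>j\<in>J. Q k j x))" for k
    by (rule countable_essential_union) (rule assms)
  then obtain J where J: "\<And>k. J k \<subseteq> I" "\<And>k. countable (J k)"
    "\<And>k. \<forall>i\<in>I. \<forall>\<^sub>F x in comeager. Q k i x \<longrightarrow> (\<exists>j\<in>J k. Q k j x)"
    by metis
  have "\<forall>\<^sub>F x in comeager. \<forall>k. Q k i x \<longrightarrow> (\<exists>j\<in>\<Union>k. J k. Q k j x)" if "i \<in> I" for i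
  proof (rule eventually_comeager_all)
    fix k
    have "\<forall>\<^sub>F x in comeager. Q k i x \<longrightarrow> (\<exists>j\<in>J k. Q k j x)"
      using J(3) that by blast
    then show "\<forall>\<^sub>F x in comeager. Q k i x \<longrightarrow> (\<exists>j\<in>\<Union>k. J k. Q k j x)"
      by eventually_elim blast
  qed
  moreover have "(\<Union>k. J k) \<subseteq> I" "countable (\<Union>k. J k)"
    using J(1,2) by auto
  ultimately show ?thesis
    by blast
qed

lemma topological_zero_one_law:
  assumes "countable \<Gamma>" and "\<And>\<gamma>. \<gamma> \<in> \<Gamma> \<Longrightarrow> filterlim \<gamma> comeager comeager"
    and orbits: "\<And>U. open U \<Longrightarrow> U \<noteq> {} \<Longrightarrow> \<forall>\<^sub>F x in comeager. \<exists>\<gamma>\<in>\<Gamma>. \<gamma> x \<in> U"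
    and "Measurable.pred baire_algebra Q"
    and invariant: "\<And>\<gamma> x. \<gamma> \<in> \<Gamma> \<Longrightarrow> Q (\<gamma> x) \<Longrightarrow> Q x"
  shows "(\<forall>\<^sub>F x in comeager. Q x) \<or> (\<forall>\<^sub>F x in comeager. \<not> Q x)"
proof (rule disjCI)
  assume "\<not> (\<forall>\<^sub>F x in comeager. \<not> Q x)"
  then obtain U where U: "open U" "U \<noteq> {}" "\<forall>\<^sub>F x in comeager. x \<in> U \<longrightarrow> Q x"
    using frequently_comeager_imp_localized assms(4) unfolding frequently_def by blast
  have "\<forall>\<^sub>F x in comeager. \<forall>\<gamma>\<in>\<Gamma>. \<gamma> x \<in> U \<longrightarrow> Q (\<gamma> x)"
    using assms(1,2) U(3) by (intro eventually_comeager_ball) (auto simp: filterlim_iff)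
  then show "\<forall>\<^sub>F x in comeager. Q x"
    using orbits[OF U(1,2)] by eventually_elim (use invariant in blast)
qed

subsection \<open>Product spaces\<close>

lemma eventually_comeager_section_dense:
  fixes U :: "('a::topological_space \<times> 'b::second_countable_topology) set"
  assumes "open U" "closure U = UNIV"
  shows "\<forall>\<^sub>F x in comeager. closure (Pair x -` U) = UNIV"
proof -
  obtain B :: "'b set set" where B: "countable B" "topological_basis B"
    using ex_countable_basis by blast
  have "\<forall>\<^sub>F x in comeager. x \<in> fst ` (U \<inter> (UNIV \<times> b))" if b: "b \<in> B - {{}}" for b
  proof (rule eventually_comeager_open_dense)
    have "open b"
      using topological_basis_open[OF B(2)] b by blast
    then show "open (fst ` (U \<inter> (UNIV \<times> b)))"
      using assms(1) by (intro open_image_fst open_Int open_Times) auto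
    fix W :: "'a set" assume "open W" "W \<noteq> {}"
    then have "(W \<times> b) \<inter> U \<noteq> {}"
      using open_Int_closure_eq_empty[of "W \<times> b" U] assms(2) b \<open>open b\<close> by (simp add: open_Times)
    then show "\<exists>x\<in>W. x \<in> fst ` (U \<inter> (UNIV \<times> b))"
      by force
  qed
  then have "\<forall>\<^sub>F x in comeager. \<forall>b\<in>B - {{}}. x \<in> fst ` (U \<inter> (UNIV \<times> b))"
    using B(1) by (intro eventually_comeager_ball) simp_all
  then show ?thesis
  proof eventually_elim
    case (elim x)
    have "y \<in> closure (Pair x -` U)" for y
      unfolding closure_iff_nhds_not_empty
    proof (intro allI impI)
      fix A V assume "V \<subseteq> A" "y \<in> V" "open V"
      then obtain b where b: "b \<in> B" "y \<in> b" "b \<subseteq> V"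
        using topological_basisE[OF B(2)] by metis
      then have "x \<in> fst ` (U \<inter> (UNIV \<times> b))"
        using elim by blast
      then obtain z where "z \<in> b" "(x, z) \<in> U"
        by auto
      then show "Pair x -` U \<inter> A \<noteq> {}"
        using b(3) \<open>V \<subseteq> A\<close> by blast
    qed
    then show ?case
      by blast
  qed
qed

theorem kuratowski_ulam:
  fixes Q :: "'a::topological_space \<times> 'b::second_countable_topology \<Rightarrow> bool"
  assumes "\<forall>\<^sub>F p in comeager. Q p"
  shows "\<forall>\<^sub>F x in comeager. \<forall>\<^sub>F y in comeager. Q (x, y)"
proof -
  obtain G where G: "countable G" "\<forall>U\<in>G. open U \<and> closure U = UNIV"
    "\<forall>p. (\<forall>U\<in>G. p \<in> U) \<longrightarrow> Q p"
    using assms unfolding eventually_comeager by blast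
  have "\<forall>\<^sub>F x in comeager. \<forall>U\<in>G. closure (Pair x -` U) = UNIV"
    using G(2) by (intro eventually_comeager_ball[OF G(1)] eventually_comeager_section_dense) auto
  then show ?thesis
  proof eventually_elim
    case (elim x)
    have "open (Pair x -` U)" if "U \<in> G" for U
      using G(2) that by (intro open_vimage continuous_intros) auto
    then have "\<forall>V\<in>(\<lambda>U. Pair x -` U) ` G. open V \<and> closure V = UNIV"
      using elim by simp
    moreover have "\<forall>y. (\<forall>V\<in>(\<lambda>U. Pair x -` U) ` G. y \<in> V) \<longrightarrow> Q (x, y)"
      using G(3) by simp
    ultimately show ?case
      unfolding eventually_comeager using G(1) by (intro exI[of _ "(\<lambda>U. Pair x -` U) ` G"]) simp
  qed
qed

lemma ex_frequently_section:
  fixes Q :: "'a::polish_topology \<times> 'b::polish_topology \<Rightarrow> bool"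
  assumes "open W" "W \<noteq> {}" and "\<forall>\<^sub>F p in comeager. p \<in> W \<longrightarrow> Q p"
  shows "\<exists>x. \<exists>\<^sub>F y in comeager. Q (x, y)"
proof -
  have "open (fst ` W)" "fst ` W \<noteq> {}"
    using assms(1,2) by (simp_all add: open_image_fst)
  then have "\<exists>\<^sub>F x in comeager. x \<in> fst ` W"
    by (rule frequently_comeager_open)
  from frequently_ex[OF frequently_eventually_frequently[OF this kuratowski_ulam[OF assms(3)]]]
  obtain x where x: "x \<in> fst ` W" "\<forall>\<^sub>F y in comeager. (x, y) \<in> W \<longrightarrow> Q (x, y)"
    by blast
  have "open (Pair x -` W)"
    by (intro open_vimage assms(1) continuous_intros)
  moreover have "Pair x -` W \<noteq> {}"
    using x(1) by auto
  ultimately have "\<exists>\<^sub>F y in comeager. y \<in> Pair x -` W"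
    by (rule frequently_comeager_open)
  from frequently_eventually_frequently[OF this x(2)] have "\<exists>\<^sub>F y in comeager. Q (x, y)"
    by (rule frequently_elim1) simp
  then show ?thesis
    by blast
qed

lemma pred_baire_algebra_frequently:
  fixes Q :: "'a::topological_space \<times> 'b::polish_topology \<Rightarrow> bool"
  assumes "Measurable.pred baire_algebra Q" and "open V"
  shows "Measurable.pred baire_algebra (\<lambda>x. \<exists>\<^sub>F y in comeager. y \<in> V \<and> Q (x, y))"
proof -
  obtain U where U: "open U" "\<forall>\<^sub>F p in comeager. Q p \<longleftrightarrow> p \<in> U"
    using assms(1) by (auto simp: pred_baire_algebra_iff)
  have open_case: "(\<exists>\<^sub>F y in comeager. y \<in> V \<and> (x, y) \<in> U) \<longleftrightarrow> x \<in> fst ` (U \<inter> (UNIV \<times> V))" for x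
  proof -
    have op: "open (V \<inter> Pair x -` U)"
      by (intro open_Int assms(2) open_vimage U(1) continuous_intros)
    have "(\<exists>\<^sub>F y in comeager. y \<in> V \<inter> Pair x -` U) \<longleftrightarrow> V \<inter> Pair x -` U \<noteq> {}"
      using frequently_comeager_open[OF op] by (cases "V \<inter> Pair x -` U = {}") simp_all
    moreover have "V \<inter> Pair x -` U \<noteq> {} \<longleftrightarrow> x \<in> fst ` (U \<inter> (UNIV \<times> V))"
      by force
    ultimately show ?thesis
      by simp
  qed
  have "\<forall>\<^sub>F x in comeager. (\<exists>\<^sub>F y in comeager. y \<in> V \<and> Q (x, y)) \<longleftrightarrow> x \<in> fst ` (U \<inter> (UNIV \<times> V))"
    using kuratowski_ulam[OF U(2)]
  proof eventually_elim
    case (elim x)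
    then have "(\<exists>\<^sub>F y in comeager. y \<in> V \<and> Q (x, y)) \<longleftrightarrow> (\<exists>\<^sub>F y in comeager. y \<in> V \<and> (x, y) \<in> U)"
      unfolding frequently_def
      by (intro arg_cong[where f = Not] eventually_subst) (auto elim: eventually_mono)
    then show ?case
      using open_case by blast
  qed
  moreover have "open (fst ` (U \<inter> (UNIV \<times> V)))"
    using U(1) assms(2) by (intro open_image_fst open_Int open_Times) auto
  ultimately show ?thesis
    unfolding pred_baire_algebra_iff by blast
qed

subsection \<open>Sequence spaces\<close>

lemma open_fun_prefix:
  fixes W :: "(nat \<Rightarrow> 'a::topological_space) set"
  assumes "open W" "x \<in> W"
  shows "\<exists>n. \<forall>y. (\<forall>i<n. y i = x i) \<longrightarrow> y \<in> W"
proof -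
  obtain X where X: "x \<in> Pi\<^sub>E UNIV X" "finite {i. X i \<noteq> UNIV}" "Pi\<^sub>E UNIV X \<subseteq> W"
    using product_topology_open_contains_basis[of "\<lambda>i. euclidean" UNIV W x] assms
    by (auto simp: open_fun_def)
  obtain n where n: "\<And>i. X i \<noteq> UNIV \<Longrightarrow> i < n"
    using X(2) finite_nat_set_iff_bounded by auto
  have "y \<in> W" if "\<forall>i<n. y i = x i" for y
  proof (rule subsetD[OF X(3)])
    show "y \<in> Pi\<^sub>E UNIV X"
      using X(1) n that by (auto simp: PiE_iff) (metis UNIV_I)
  qed
  then show ?thesis
    by (intro exI[of _ n] allI impI)
qed

definition cylinder :: "'a list \<Rightarrow> (nat \<Rightarrow> 'a) set" where
  "cylinder l = {h. \<forall>i<length l. h i = l ! i}"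

lemma open_cylinder: "open (cylinder (l :: 'a::discrete_topology list))"
proof -
  have "cylinder l = {h. \<forall>i\<in>{..<length l}. h i \<in> {l ! i}}"
    by (auto simp: cylinder_def)
  then show ?thesis
    using product_topology_basis'[of "{..<length l}" "\<lambda>i. {l ! i}" "\<lambda>i. i"] by (simp add: open_discrete)
qed

lemma cylinder_nonempty: "cylinder l \<noteq> {}"
  by (auto simp: cylinder_def)

lemma ex_cylinder_subset_open:
  fixes W :: "(nat \<Rightarrow> 'a::topological_space) set"
  assumes "open W" "W \<noteq> {}"
  shows "\<exists>l. cylinder l \<subseteq> W"
proof -
  obtain h where "h \<in> W"
    using assms(2) by blast
  then obtain n where n: "\<forall>y. (\<forall>i<n. y i = h i) \<longrightarrow> y \<in> W"
    using open_fun_prefix[OF assms(1)] by blast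
  have "cylinder (map h [0..<n]) \<subseteq> W"
    using n by (auto simp: cylinder_def)
  then show ?thesis
    by blast
qed

section \<open>Countable ordinals\<close>

unbundle cardinal_syntax

definition omega1 :: "'a::wellorder set" where
  "omega1 = {t. countable {..t}}"

lemma omega1_downward_closed: "t \<in> omega1 \<Longrightarrow> s \<le> t \<Longrightarrow> s \<in> omega1"
  unfolding omega1_def by (auto elim!: countable_subset[rotated])

lemma countable_below_omega1:
  assumes "t \<in> omega1" "A \<subseteq> {..t}" shows "countable A"
  using assms unfolding omega1_def by (auto intro: countable_subset)

lemma uncountable_omega1:
  assumes "uncountable (UNIV :: 'a::wellorder set)"
  shows "uncountable (omega1 :: 'a set)"
proof
  assume countable: "countable (omega1 :: 'a set)"
  define m where "m = (LEAST t::'a. t \<notin> omega1)"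
  have "\<exists>t::'a. t \<notin> omega1"
    using countable assms by (metis UNIV_eq_I)
  then have "m \<notin> omega1"
    unfolding m_def by (rule LeastI_ex)
  moreover have "{..m} \<subseteq> insert m omega1"
    using not_less_Least[of _ "\<lambda>t::'a. t \<notin> omega1"] unfolding m_def by (auto simp: le_less)
  ultimately show False
    using countable countable_subset[of "{..m}" "insert m omega1"] by (simp add: omega1_def)
qed

lemma omega1_strict_upper_bound:
  fixes S :: "'a::wellorder set"
  assumes "uncountable (UNIV :: 'a set)" "countable S" "S \<subseteq> omega1"
  obtains t where "t \<in> omega1" "\<And>s. s \<in> S \<Longrightarrow> s < t"
proof -
  have "countable (\<Union>s\<in>S. {..s})"
    using assms(2,3) by (auto simp: omega1_def)
  then obtain t where "t \<in> omega1" "t \<notin> (\<Union>s\<in>S. {..s})"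
    using uncountable_omega1[OF assms(1)] by (meson countable_subset subsetI)
  then show thesis
    using that[of t] by (auto simp: not_le)
qed

definition is_limit :: "'a::wellorder \<Rightarrow> bool" where
  "is_limit t \<longleftrightarrow> (\<exists>s. s < t) \<and> (\<forall>s<t. \<exists>u>s. u < t)"

lemma ex_limit_closed_under:
  fixes next_time :: "'a::wellorder \<Rightarrow> 'a"
  assumes uncountable: "uncountable (UNIV :: 'a set)" and "t \<in> omega1"
    and next_time: "\<And>u. u \<in> omega1 \<Longrightarrow> next_time u \<in> omega1 \<and> u < next_time u"
  obtains g where "g \<in> omega1" "t < g" "is_limit g" "\<And>s. s < g \<Longrightarrow> \<exists>u\<in>omega1. s \<le> u \<and> next_time u < g"
proof -
  define \<tau> where "\<tau> n = (next_time ^^ n) t" for n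
  have \<tau>_Suc: "\<tau> (Suc n) = next_time (\<tau> n)" for n
    by (simp add: \<tau>_def)
  have \<tau>: "\<tau> n \<in> omega1" for n
    by (induction n) (auto simp: \<tau>_def assms)
  obtain b where b: "b \<in> omega1" "\<forall>n. \<tau> n < b"
    using omega1_strict_upper_bound[OF uncountable, of "range \<tau>"] \<tau>
    by (metis countable_image countableI_type image_subsetI rangeI)
  define g where "g = (LEAST g. \<forall>n. \<tau> n < g)"
  have g: "\<tau> n < g" for n
    using LeastI[of "\<lambda>g. \<forall>n. \<tau> n < g", OF b(2)] unfolding g_def by blast
  have "g \<le> b"
    unfolding g_def using b(2) by (rule Least_le)
  have cofinal: "\<exists>u\<in>omega1. s \<le> u \<and> next_time u < g" if "s < g" for s
  proof -
    obtain n where "s \<le> \<tau> n"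
      using not_less_Least[of s "\<lambda>g. \<forall>n. \<tau> n < g"] \<open>s < g\<close> unfolding g_def by (meson not_less)
    then show ?thesis
      using \<tau>[of n] g[of "Suc n"] \<tau>_Suc by metis
  qed
  have "is_limit g"
    unfolding is_limit_def using cofinal g next_time by (meson le_less_trans)
  moreover have "t < g"
    using g[of 0] by (simp add: \<tau>_def)
  ultimately show thesis
    using that cofinal omega1_downward_closed[OF b(1) \<open>g \<le> b\<close>] by blast
qed

lemma countable_lower_sets_below:
  assumes "t \<in> omega1"
  shows "countable {A. A \<subseteq> {..t} \<and> (\<forall>s\<in>A. {..s} \<subseteq> A)}"
proof (rule countable_subset)
  show "countable (insert {..t} (lessThan ` {..t}))"
    using assms by (simp add: omega1_def)
  have "A \<in> lessThan ` {..t}" if A: "A \<subseteq> {..t}" "\<forall>s\<in>A. {..s} \<subseteq> A" and "A \<noteq> {..t}" for A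
  proof -
    obtain s where s: "s \<le> t" "s \<notin> A"
      using A(1) \<open>A \<noteq> {..t}\<close> by auto
    define m where "m = (LEAST s. s \<notin> A)"
    have m: "m \<notin> A" "m \<le> s"
      unfolding m_def using LeastI[of "\<lambda>s. s \<notin> A", OF s(2)] Least_le[of "\<lambda>s. s \<notin> A", OF s(2)] by auto
    have "u \<in> A \<longleftrightarrow> u < m" for u
    proof
      show "u < m" if "u \<in> A"
        using A(2) m(1) that by (meson atMost_iff not_less subsetD)
      show "u \<in> A" if "u < m"
        using not_less_Least[of u "\<lambda>s. s \<notin> A"] that unfolding m_def by blast
    qed
    then show ?thesis
      using m(2) s(1) by auto
  qed
  then show "{A. A \<subseteq> {..t} \<and> (\<forall>s\<in>A. {..s} \<subseteq> A)} \<subseteq> insert {..t} (lessThan ` {..t})"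
    by blast
qed

section \<open>Infinite time computations\<close>

subsection \<open>Time lines and their embeddings\<close>

abbreviation tail :: "'a::wellorder \<Rightarrow> 'a rel" where
  "tail v \<equiv> {(s, t). v \<le> s \<and> s \<le> t}"

lemma Field_tail: "Field (tail v) = {v..}"
  by (auto simp: Field_def)

lemma underS_tail: "underS (tail v) t = {v..<t}"
  by (auto simp: underS_def)

lemma underS_le: "underS {(s, t). s \<le> t} t = {..<(t::'a::wellorder)}"
  by (auto simp: underS_def)

lemma tail_Least: "tail (LEAST t. True) = {(s, t). s \<le> t}"
  by (auto intro: Least_le)

lemma Well_order_tail: "Well_order (tail v)"
proof -
  have "wf (tail v - Id)"
    by (rule wf_subset[OF wf]) auto
  then show ?thesis
    unfolding well_order_on_def linear_order_on_def partial_order_on_def preorder_on_def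
    by (auto simp: Field_tail refl_on_def trans_def antisym_def total_on_def)
qed

lemma Well_order_le: "Well_order {(s, t). s \<le> (t::'a::wellorder)}"
  using Well_order_tail[of "LEAST t. True"] by (simp only: tail_Least)

lemma embed_order_iff:
  assumes "Well_order r" "Well_order r'" "embed r r' f" "x \<in> Field r" "y \<in> Field r"
  shows "(f x, f y) \<in> r' \<longleftrightarrow> (x, y) \<in> r"
  using embed_implies_iso_Restr[OF assms(2,1,3)] assms(4,5) unfolding iso_iff2 by auto

lemma ex_embed_of_card_less:
  assumes "Well_order r" "|Field r| <o |UNIV :: 'a::wellorder set|"
  obtains f where "embed r {(s, t). s \<le> (t::'a)} f"
proof -
  let ?le = "{(s, t). s \<le> (t::'a)}"
  have "Field ?le = UNIV"
    by (auto simp: Field_def)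
  then have "\<not> ?le <o r"
    using assms(2) card_of_mono2[OF ordLess_imp_ordLeq, of ?le r] not_ordLess_ordLeq by auto
  then show thesis
    using that assms(1) Well_order_le by (auto simp: ordLess_iff)
qed

lemma ex_embed_tail:
  assumes "g \<le> (v::'a::wellorder)"
  obtains f where "embed (tail v) (tail g) f"
proof -
  have "\<not> tail g <o tail v"
  proof
    assume "tail g <o tail v"
    then obtain f where "embedS (tail g) (tail v) f"
      unfolding ordLess_def by blast
    then have f: "embed (tail g) (tail v) f" "f ` {g..} \<subset> {v..}"
      using embedS_iff[OF Well_order_tail, of g "tail v" f] by (auto simp: embedS_def Field_tail)
    have "wo_rel (tail v)"
      unfolding wo_rel_def by (rule Well_order_tail)
    then obtain a where a: "v \<le> a" "f ` {g..} = {v..<a}"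
      using wo_rel.ofilter_underS_Field[of "tail v" "f ` {g..}"] f(2)
        embed_Field_ofilter[OF Well_order_tail Well_order_tail f(1)]
      by (auto simp: Field_tail underS_tail)
    have range: "f x \<in> {v..<a}" if "g \<le> x" for x
      unfolding a(2)[symmetric] using that by simp
    have mono: "f x < f y" if "g \<le> x" "x < y" for x y
      using embed_order_iff[OF Well_order_tail Well_order_tail f(1), of y x] range[of y] that
      by (fastforce simp: Field_tail)
    have "x \<le> f x" if "g \<le> x" for x
      using that
    proof (induction x rule: less_induct)
      case (less x)
      have "g \<le> f x"
        using range[OF less.prems] assms by (meson atLeastLessThan_iff order_trans)
      then show ?case
        using less.IH[of "f x"] mono[of "f x" x] by (meson leD not_less)
    qed
    then show False
      using range[of a] a(1) assms by (meson atLeastLessThan_iff leD order_trans)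
  qed
  then show thesis
    using that Well_order_tail by (auto simp: ordLess_iff)
qed

subsection \<open>Runs\<close>

definition evolution :: "prog \<Rightarrow> 't rel \<Rightarrow> ('t \<Rightarrow> config) \<Rightarrow> bool" where
  "evolution P r c \<longleftrightarrow> (\<forall>t\<in>Field r.
     (\<forall>s. immediate_pred r s t \<longrightarrow> c t = step P (c s)) \<and>
     (is_limit_in r t \<longrightarrow> c t = limit_config r t c))"

lemma lt_in_iff_underS: "lt_in r s t \<longleftrightarrow> s \<in> underS r t"
  by (auto simp: lt_in_def underS_def)

lemma immediate_pred_underS:
  "immediate_pred r s t \<longleftrightarrow> s \<in> underS r t \<and> \<not> (\<exists>u\<in>underS r t. s \<in> underS r u)"
  unfolding immediate_pred_def lt_in_iff_underS using Order_Relation.underS_Field[of r t] by blast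

lemma limsup_before_underS:
  "limsup_before r t p \<longleftrightarrow> (\<forall>s\<in>underS r t. \<exists>u\<in>underS r t. (s, u) \<in> r \<and> p u)"
  unfolding limsup_before_def lt_in_iff_underS using Order_Relation.underS_Field[of r t] by blast

lemma limit_config_eqI:
  assumes "\<And>p. limsup_before r t (\<lambda>u. p (c u)) = limsup_before r' t' (\<lambda>u. p (c' u))"
  shows "limit_config r t c = limit_config r' t' c'"
  unfolding limit_config_def
  using assms[of "\<lambda>d. inp d _"] assms[of "\<lambda>d. scr d _"] assms[of "\<lambda>d. out d _"] by simp

context
  fixes r :: "'s rel" and r' :: "'t rel" and f :: "'s \<Rightarrow> 't"
  assumes wo: "Well_order r" "Well_order r'" and emb: "embed r r' f"
begin

lemma image_underS: "t \<in> Field r \<Longrightarrow> f ` underS r t = underS r' (f t)"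
  using embed_underS[OF wo(1) emb] by (simp add: bij_betw_def)

lemma underS_embed_iff: "s \<in> Field r \<Longrightarrow> t \<in> Field r \<Longrightarrow> f s \<in> underS r' (f t) \<longleftrightarrow> s \<in> underS r t"
  using embed_order_iff[OF wo emb] embed_inj_on[OF wo(1) emb] by (auto simp: underS_def inj_on_eq_iff)

lemma immediate_pred_embed_iff:
  assumes "s \<in> Field r" "t \<in> Field r"
  shows "immediate_pred r' (f s) (f t) \<longleftrightarrow> immediate_pred r s t"
proof -
  have "f s \<in> underS r' (f u) \<longleftrightarrow> s \<in> underS r u" if "u \<in> underS r t" for u
    using underS_embed_iff[OF assms(1)] Order_Relation.underS_Field[of r t] that by blast
  then have "(\<exists>u\<in>underS r' (f t). f s \<in> underS r' u) \<longleftrightarrow> (\<exists>u\<in>underS r t. s \<in> underS r u)"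
    unfolding image_underS[OF assms(2), symmetric] by simp
  then show ?thesis
    unfolding immediate_pred_underS by (simp add: underS_embed_iff[OF assms])
qed

lemma is_limit_in_embed:
  assumes "t \<in> Field r" "is_limit_in r t"
  shows "is_limit_in r' (f t)"
proof -
  obtain s where "s \<in> Field r" "(t, s) \<notin> r"
    using assms(2) unfolding is_limit_in_def is_least_in_def by blast
  then have "\<not> is_least_in r' (f t)"
    using embed_order_iff[OF wo emb] embed_in_Field[OF emb] assms(1) unfolding is_least_in_def by metis
  moreover have "\<not> immediate_pred r' s' (f t)" for s'
  proof
    assume pred: "immediate_pred r' s' (f t)"
    then obtain s where "s \<in> Field r" "s' = f s"
      using image_underS[OF assms(1)] Order_Relation.underS_Field[of r t]
      unfolding immediate_pred_underS by blast
    then show False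
      using pred immediate_pred_embed_iff assms unfolding is_limit_in_def by blast
  qed
  ultimately show ?thesis
    unfolding is_limit_in_def by blast
qed

lemma limsup_before_embed:
  assumes "t \<in> Field r" and "\<And>u. u \<in> underS r t \<Longrightarrow> p u = p' (f u)"
  shows "limsup_before r t p = limsup_before r' (f t) p'"
proof -
  have "(f s, f u) \<in> r' \<longleftrightarrow> (s, u) \<in> r" if "s \<in> underS r t" "u \<in> underS r t" for s u
    using embed_order_iff[OF wo emb] Order_Relation.underS_Field[of r t] that by blast
  then show ?thesis
    unfolding limsup_before_underS image_underS[OF assms(1), symmetric]
    using assms(2) by simp
qed

lemma evolution_embed_eq:
  assumes "evolution P r c" "evolution P r' c'"
    and start: "\<And>t. t \<in> Field r \<Longrightarrow> is_least_in r t \<Longrightarrow> c t = c' (f t)"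
    and "t \<in> Field r"
  shows "c t = c' (f t)"
proof -
  have "wf (r - Id)"
    using wo(1) by (simp add: well_order_on_def)
  then show ?thesis
    using \<open>t \<in> Field r\<close>
  proof (induction t rule: wf_induct_rule)
    case (less t)
    have IH: "c u = c' (f u)" if "u \<in> underS r t" for u
      using less that Order_Relation.underS_Field[of r t] by (auto simp: underS_def)
    have "f t \<in> Field r'"
      using embed_in_Field[OF emb less.prems] .
    consider (least) "is_least_in r t" | (successor) s where "immediate_pred r s t"
      | (limit) "is_limit_in r t"
      unfolding is_limit_in_def by blast
    then show ?case
    proof cases
      case least
      then show ?thesis
        using start less.prems by blast
    next
      case (successor s)
      then have "s \<in> Field r" "s \<in> underS r t"
        using Order_Relation.underS_Field[of r t] by (auto simp: immediate_pred_underS)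
      then have "c' (f t) = step P (c' (f s))"
        using assms(2) successor less.prems immediate_pred_embed_iff \<open>f t \<in> Field r'\<close>
        unfolding evolution_def by blast
      then show ?thesis
        using assms(1) successor less.prems IH[OF \<open>s \<in> underS r t\<close>] unfolding evolution_def by auto
    next
      case limit
      have "limit_config r t c = limit_config r' (f t) c'"
        using IH less.prems by (intro limit_config_eqI limsup_before_embed) auto
      then show ?thesis
        using assms(1,2) limit less.prems is_limit_in_embed \<open>f t \<in> Field r'\<close>
        unfolding evolution_def by auto
    qed
  qed
qed

end

lemma stage_cases:
  fixes t :: "'a::wellorder"
  obtains (least) "\<And>s. t \<le> s" | (successor) s where "s < t" "\<And>u. u < t \<Longrightarrow> u \<le> s" | (limit) "is_limit t"
  unfolding is_limit_def not_less[symmetric] by blast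

text \<open>Runs are continued past a halting stage.\<close>

definition run :: "prog \<Rightarrow> cantor \<Rightarrow> 'a::wellorder \<Rightarrow> config" where
  "run P w = wfrec {(s, t). s < t} (\<lambda>c t.
     if is_limit t then limit_config {(s, t). s \<le> t} t c
     else if \<exists>s. s < t then step P (c (GREATEST s. s < t))
     else init_config w)"

lemma limsup_before_tail:
  assumes "v < t"
  shows "limsup_before (tail v) t p \<longleftrightarrow> (\<forall>s<t. \<exists>u\<ge>s. u < t \<and> p u)"
proof
  assume unbounded: "limsup_before (tail v) t p"
  show "\<forall>s<t. \<exists>u\<ge>s. u < t \<and> p u"
  proof (intro allI impI)
    fix s assume "s < t"
    then have "max s v \<in> underS (tail v) t"
      using assms by (simp add: underS_tail)
    then obtain u where "u \<in> underS (tail v) t" "(max s v, u) \<in> tail v" "p u"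
      using unbounded unfolding limsup_before_underS by blast
    then show "\<exists>u\<ge>s. u < t \<and> p u"
      by (auto simp: underS_tail)
  qed
next
  assume "\<forall>s<t. \<exists>u\<ge>s. u < t \<and> p u"
  then have "\<exists>u\<in>{v..<t}. (s, u) \<in> tail v \<and> p u" if "s \<in> {v..<t}" for s
    using that order_trans[of v s] by (simp add: Bex_def) blast
  then show "limsup_before (tail v) t p"
    unfolding limsup_before_underS underS_tail by blast
qed

lemma limsup_before_le:
  fixes t :: "'a::wellorder"
  shows "limsup_before {(s, t). s \<le> t} t p \<longleftrightarrow> (\<forall>s<t. \<exists>u\<ge>s. u < t \<and> p u)"
  unfolding limsup_before_underS underS_le by auto

lemma run_unfold:
  "run P w t = (if is_limit t then limit_config {(s, t). s \<le> t} t (run P w)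
     else if \<exists>s. s < t then step P (run P w (GREATEST s. s < t))
     else init_config w)"
proof -
  let ?less = "{(s, t). s < (t::'a)}"
  have cut_limit:
    "limit_config {(s, t). s \<le> t} t (cut (run P w) ?less t) = limit_config {(s, t). s \<le> t} t (run P w)"
    by (rule limit_config_eqI) (simp add: limsup_before_le cut_apply cong: conj_cong)
  have "(GREATEST s. s < t) < t" if "\<not> is_limit t" "\<exists>s. s < t"
  proof (cases t rule: stage_cases)
    case (successor s)
    then have "(GREATEST s. s < t) = s"
      by (rule Greatest_equality)
    then show ?thesis
      using successor(1) by simp
  qed (use that in \<open>auto simp: not_less[symmetric]\<close>)
  then have "cut (run P w) ?less t (GREATEST s. s < t) = run P w (GREATEST s. s < t)"
    if "\<not> is_limit t" "\<exists>s. s < t"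
    using that by (simp add: cut_apply)
  then show ?thesis
    using def_wfrec[OF run_def[THEN eq_reflection] wf, of P w t] by (simp add: cut_limit)
qed

lemma run_least:
  assumes "\<And>s. t \<le> s" shows "run P w t = init_config w"
proof -
  have "\<not> s < t" for s
    using assms[of s] by simp
  then show ?thesis
    by (subst run_unfold) (simp add: is_limit_def)
qed

lemma run_successor:
  assumes "s < t" and "\<And>u. u < t \<Longrightarrow> u \<le> s"
  shows "run P w t = step P (run P w s)"
proof -
  have "(GREATEST s. s < t) = s"
    using assms by (rule Greatest_equality)
  moreover have "\<not> is_limit t"
    using assms unfolding is_limit_def not_less[symmetric] by blast
  ultimately show ?thesis
    using assms(1) by (subst run_unfold) auto
qed

lemma run_limit:
  assumes "is_limit t" "v < t"
  shows "run P w t = limit_config (tail v) t (run P w)"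
proof -
  have "limit_config {(s, t). s \<le> t} t (run P w) = limit_config (tail v) t (run P w)"
    by (rule limit_config_eqI) (simp add: limsup_before_le limsup_before_tail[OF assms(2)])
  then show ?thesis
    using assms(1) by (subst run_unfold) simp
qed

lemma evolution_run: "evolution P (tail v) (run P w)"
  unfolding evolution_def
proof (intro ballI conjI allI impI)
  fix t s assume pred: "immediate_pred (tail v) s t"
  then have s: "v \<le> s" "s < t"
    by (simp_all add: immediate_pred_underS underS_tail)
  have "u \<le> s" if "u < t" for u
  proof (cases "v \<le> u")
    case True
    then show ?thesis
      using pred s(1) that by (auto simp: immediate_pred_underS underS_tail not_less)
  qed (use s(1) in simp)
  then show "run P w t = step P (run P w s)"
    by (rule run_successor[OF s(2)])
next
  fix t assume t: "t \<in> Field (tail v)" and lim: "is_limit_in (tail v) t"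
  have "v < t"
    using t lim unfolding is_limit_in_def is_least_in_def Field_tail by (auto simp: le_less)
  moreover have "is_limit t"
  proof (cases t rule: stage_cases)
    case least
    then show ?thesis using \<open>v < t\<close> by (simp add: leD)
  next
    case (successor s)
    then have "immediate_pred (tail v) s t"
      using \<open>v < t\<close> by (auto simp: immediate_pred_underS underS_tail not_less)
    then show ?thesis using lim unfolding is_limit_in_def by blast
  qed
  ultimately show "run P w t = limit_config (tail v) t (run P w)"
    by (intro run_limit)
qed

lemma ittm_run_eq_run:
  fixes f :: "'t \<Rightarrow> 'a::wellorder"
  assumes "ittm_run r c P w" and emb: "embed r {(s, t). s \<le> t} f" and "x \<in> Field r"
  shows "c x = run P w (f x)"
proof (rule evolution_embed_eq[OF _ Well_order_le emb])
  show wo: "Well_order r" and "evolution P r c"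
    using assms(1) unfolding ittm_run_def evolution_def by auto
  show "evolution P {(s, t). s \<le> (t::'a)} (run P w)"
    using evolution_run[of P "LEAST t. True" w] by (simp only: tail_Least)
  fix t assume t: "t \<in> Field r" "is_least_in r t"
  have "antisym r"
    using wo by (simp add: well_order_on_def linear_order_on_def partial_order_on_def)
  then have "underS r t = {}"
    using t(2) Order_Relation.underS_Field[of r t] by (auto simp: is_least_in_def underS_def antisym_def)
  then have "\<And>s. \<not> s < f t"
    using image_underS[OF wo Well_order_le emb t(1)] by (auto simp: underS_le)
  then have "run P w (f t) = init_config w"
    by (intro run_least) (simp add: not_less)
  then show "c t = run P w (f t)"
    using assms(1) t unfolding ittm_run_def by auto
qed (rule assms(3))

definition halts_at :: "prog \<Rightarrow> cantor \<Rightarrow> 'a::wellorder \<Rightarrow> bool" where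
  "halts_at P w t \<longleftrightarrow> st (run P w t) = halt_state \<and> (\<forall>s<t. st (run P w s) \<noteq> halt_state)"

lemma halts_at_unique: "halts_at P w s \<Longrightarrow> halts_at P w t \<Longrightarrow> s = t"
  unfolding halts_at_def by (metis linorder_neqE)

lemma halts_with_imp_halts_at:
  assumes "halts_with P w y" and large: "|UNIV :: nat set set| <o |UNIV :: 'a::wellorder set|"
  obtains t :: "'a::wellorder" where "halts_at P w t" "out (run P w t) = y"
proof -
  obtain r :: "nat set rel" and c m where r: "ittm_run r c P w" "m \<in> Field r"
    "\<forall>s\<in>Field r. (s, m) \<in> r" "st (c m) = halt_state" "out (c m) = y"
    using assms(1) unfolding halts_with_def by blast
  have wo: "Well_order r"
    using r(1) unfolding ittm_run_def by blast
  have "|Field r| <o |UNIV :: 'a set|"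
    using card_of_mono1[of "Field r" UNIV] large by (auto intro: ordLeq_ordLess_trans)
  then obtain f :: "nat set \<Rightarrow> 'a" where emb: "embed r {(s, t). s \<le> t} f"
    by (rule ex_embed_of_card_less[OF wo])
  note run = ittm_run_eq_run[OF r(1) emb]
  have "st (run P w s) \<noteq> halt_state" if "s < f m" for s
  proof
    assume halted: "st (run P w s) = halt_state"
    have "s \<in> f ` underS r m"
      using image_underS[OF wo Well_order_le emb r(2)] that by (simp add: underS_le)
    then obtain x where x: "x \<in> underS r m" "s = f x"
      by blast
    then have "x \<in> Field r"
      using Order_Relation.underS_Field[of r m] by blast
    then have "(m, x) \<in> r"
      using r(1,2) halted run x(2) unfolding ittm_run_def by metis
    then show False
      using embed_order_iff[OF wo Well_order_le emb r(2) \<open>x \<in> Field r\<close>] x(2) that by simp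
  qed
  then show thesis
    using that[of "f m"] run[OF r(2)] r(4,5) by (simp add: halts_at_def)
qed

subsection \<open>Loops\<close>

fun cell :: "config \<Rightarrow> nat + nat + nat \<Rightarrow> bool" where
  "cell c (Inl i) = inp c i"
| "cell c (Inr (Inl i)) = scr c i"
| "cell c (Inr (Inr i)) = out c i"

lemma config_eqI:
  fixes c c' :: config
  assumes "st c = st c'" "hd c = hd c'" "\<And>k. cell c k = cell c' k"
  shows "c = c'"
proof -
  have "inp c = inp c'" "scr c = scr c'" "out c = out c'"
    using assms(3)[of "Inl _"] assms(3)[of "Inr (Inl _)"] assms(3)[of "Inr (Inr _)"] by auto
  then show ?thesis
    using assms(1,2) by simp
qed

lemma run_limit_simps:
  assumes "is_limit t"
  shows "st (run P w t) = limit_state" "hd (run P w t) = 0"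
    "cell (run P w t) k \<longleftrightarrow> (\<forall>s<t. \<exists>u\<ge>s. u < t \<and> cell (run P w u) k)"
proof -
  have run: "run P w t = limit_config {(s, t). s \<le> t} t (run P w)"
    using assms by (subst run_unfold) simp
  show "st (run P w t) = limit_state" "hd (run P w t) = 0"
    by (simp_all add: run limit_config_def)
  show "cell (run P w t) k \<longleftrightarrow> (\<forall>s<t. \<exists>u\<ge>s. u < t \<and> cell (run P w u) k)"
    by (cases "(run P w t, k)" rule: cell.cases) (simp_all add: run limit_config_def limsup_before_le)
qed

lemma run_eq_of_cofinal_returns:
  assumes "is_limit g" "g < x"
    and returns: "\<And>s. s < x \<Longrightarrow> \<exists>y. s < y \<and> y < x \<and> run P w y = run P w g"
    and bounded: "\<And>y k. g \<le> y \<Longrightarrow> y < x \<Longrightarrow> cell (run P w y) k \<Longrightarrow> cell (run P w g) k"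
  shows "run P w x = run P w g"
proof (rule config_eqI)
  have x: "is_limit x"
    unfolding is_limit_def using assms(2) returns by blast
  show "st (run P w x) = st (run P w g)" "hd (run P w x) = hd (run P w g)"
    using run_limit_simps(1,2)[OF x] run_limit_simps(1,2)[OF assms(1)] by simp_all
  show "cell (run P w x) k = cell (run P w g) k" for k
  proof
    assume "cell (run P w x) k"
    then obtain y where "g \<le> y" "y < x" "cell (run P w y) k"
      using run_limit_simps(3)[OF x] assms(2) by blast
    then show "cell (run P w g) k"
      by (rule bounded)
  next
    assume "cell (run P w g) k"
    then show "cell (run P w x) k"
      unfolding run_limit_simps(3)[OF x] using returns by (metis less_imp_le)
  qed
qed

lemma run_repeats_after_return:
  fixes g v :: "'a::wellorder"
  assumes "g \<le> v" and return: "run P w v = run P w g"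
  obtains f where "f v = g" "\<And>x. v \<le> x \<Longrightarrow> f ` {v..x} = {g..f x}"
    "\<And>x. v \<le> x \<Longrightarrow> run P w (f x) = run P w x"
proof -
  obtain f where emb: "embed (tail v) (tail g) f"
    using ex_embed_tail[OF assms(1)] by blast
  have "bij_betw f (under (tail v) x) (under (tail g) (f x))" if "v \<le> x" for x
    using emb that unfolding embed_def Field_tail by simp
  moreover have "under (tail v) x = {v..x}" for v x :: 'a
    by (auto simp: under_def)
  ultimately have image: "f ` {v..x} = {g..f x}" if "v \<le> x" for x
    using that by (simp add: bij_betw_def)
  have "f v = g"
    using image[of v]
    by (metis atLeastAtMost_singleton atLeastAtMost_singleton_iff image_empty image_insert order_refl)
  have "run P w x = run P w (f x)" if "v \<le> x" for x
  proof (rule evolution_embed_eq[OF Well_order_tail Well_order_tail emb evolution_run evolution_run])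
    fix t assume "t \<in> Field (tail v)" "is_least_in (tail v) t"
    then have "t = v"
      by (auto simp: is_least_in_def Field_tail intro: antisym)
    then show "run P w t = run P w (f t)"
      using \<open>f v = g\<close> return by simp
  qed (use that in \<open>simp add: Field_tail\<close>)
  then show thesis
    using that \<open>f v = g\<close> image by simp
qed

lemma ex_last_return:
  assumes "is_limit g" "g \<le> u"
    and bounded: "\<And>y k. g \<le> y \<Longrightarrow> y < u \<Longrightarrow> cell (run P w y) k \<Longrightarrow> cell (run P w g) k"
  obtains v where "g \<le> v" "v \<le> u" "run P w v = run P w g"
    "\<And>y. v < y \<Longrightarrow> y \<le> u \<Longrightarrow> run P w y \<noteq> run P w g"
proof -
  define v where "v = (LEAST b. \<forall>y. g \<le> y \<longrightarrow> y \<le> u \<longrightarrow> run P w y = run P w g \<longrightarrow> y \<le> b)"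
  have upper: "y \<le> v" if "g \<le> y" "y \<le> u" "run P w y = run P w g" for y
    using that LeastI[of "\<lambda>b. \<forall>y. g \<le> y \<longrightarrow> y \<le> u \<longrightarrow> run P w y = run P w g \<longrightarrow> y \<le> b" u]
    unfolding v_def by blast
  have least: "\<exists>y. g \<le> y \<and> y \<le> u \<and> run P w y = run P w g \<and> s < y" if "s < v" for s
    using not_less_Least[OF that[unfolded v_def]] by (auto simp: not_le)
  have "v \<le> u"
    unfolding v_def by (rule Least_le) blast
  have "g \<le> v"
    using upper assms(2) by simp
  have "run P w v = run P w g"
  proof (rule ccontr)
    assume no_return: "run P w v \<noteq> run P w g"
    then have "g < v"
      using \<open>g \<le> v\<close> by (auto simp: le_less)
    have "run P w v = run P w g"
    proof (rule run_eq_of_cofinal_returns[OF assms(1) \<open>g < v\<close>])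
      fix s assume "s < v"
      then obtain y where "g \<le> y" "y \<le> u" "run P w y = run P w g" "s < y"
        using least by blast
      then show "\<exists>y. s < y \<and> y < v \<and> run P w y = run P w g"
        using upper no_return by (metis le_less)
    qed (use bounded \<open>v \<le> u\<close> in auto)
    then show False
      using no_return by simp
  qed
  then show thesis
    using that \<open>g \<le> v\<close> \<open>v \<le> u\<close> upper by (meson leD less_le_trans less_imp_le order_trans)
qed

lemma run_loop:
  assumes "is_limit g" "g < h" and return: "run P w h = run P w g"
    and bounded: "\<And>u k. g \<le> u \<Longrightarrow> u < h \<Longrightarrow> cell (run P w u) k \<Longrightarrow> cell (run P w g) k"
    and "g \<le> u"
  shows "\<exists>x. g \<le> x \<and> x < h \<and> run P w u = run P w x"
  using \<open>g \<le> u\<close>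
proof (induction u rule: less_induct)
  case (less u)
  have "cell (run P w g) k" if "g \<le> y" "y < u" "cell (run P w y) k" for y k
    using less.IH[OF that(2,1)] bounded that(3) by metis
  then obtain v where v: "g \<le> v" "v \<le> u" "run P w v = run P w g"
    "\<And>y. v < y \<Longrightarrow> y \<le> u \<Longrightarrow> run P w y \<noteq> run P w g"
    using ex_last_return[OF assms(1) less.prems] by metis
  obtain f where f: "f v = g" "\<And>x. v \<le> x \<Longrightarrow> f ` {v..x} = {g..f x}"
    "\<And>x. v \<le> x \<Longrightarrow> run P w (f x) = run P w x"
    using run_repeats_after_return[OF v(1,3)] by blast
  have "f u < h"
  proof (rule ccontr)
    assume "\<not> f u < h"
    then have "h \<in> f ` {v..u}"
      using f(2)[OF v(2)] assms(2) by (simp add: not_less less_imp_le)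
    then obtain z where z: "v \<le> z" "z \<le> u" "h = f z"
      by auto
    then have "run P w z = run P w g"
      using f(3)[of z] return by simp
    then have "z = v"
      using v(4)[of z] z(1,2) by (auto simp: le_less)
    then show False
      using z(3) f(1) assms(2) by simp
  qed
  moreover have "g \<le> f u"
    using f(2)[OF v(2)] v(2) by auto
  ultimately show ?case
    using f(3)[OF v(2)] by metis
qed

section \<open>Generic computations\<close>

subsection \<open>Measurable dependence on the input\<close>

lemma measurable_Pair_count_space:
  fixes f :: "'a \<Rightarrow> 'b::countable"
  assumes "f \<in> M \<rightarrow>\<^sub>M count_space UNIV" "g \<in> M \<rightarrow>\<^sub>M count_space UNIV"
  shows "(\<lambda>w. (f w, g w)) \<in> M \<rightarrow>\<^sub>M count_space UNIV"
  using measurable_compose[OF assms(2) measurable_count_space]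
  by (rule measurable_compose_countable[OF _ assms(1)])

lemma pred_countable_bounded:
  assumes "countable I" and "\<And>i. i \<in> I \<Longrightarrow> Measurable.pred M (Q i)"
  shows "Measurable.pred M (\<lambda>w. \<forall>i\<in>I. Q i w)" "Measurable.pred M (\<lambda>w. \<exists>i\<in>I. Q i w)"
  using assms sets.sets_Collect_countable_All'[of I _ Q] sets.sets_Collect_countable_Ex'[of I _ Q]
  by (simp_all add: pred_def)

definition measurable_config :: "'a measure \<Rightarrow> ('a \<Rightarrow> config) \<Rightarrow> bool" where
  "measurable_config M c \<longleftrightarrow>
     (\<lambda>w. st (c w)) \<in> M \<rightarrow>\<^sub>M count_space UNIV \<and> (\<lambda>w. hd (c w)) \<in> M \<rightarrow>\<^sub>M count_space UNIV \<and>
     (\<forall>k. Measurable.pred M (\<lambda>w. cell (c w) k))"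

lemma measurable_config_init:
  assumes "\<And>i. Measurable.pred M (\<lambda>w. input w i)"
  shows "measurable_config M (\<lambda>w. init_config (input w))"
proof -
  have "Measurable.pred M (\<lambda>w. cell (init_config (input w)) k)" for k
    by (cases "(init_config (\<lambda>_. False), k)" rule: cell.cases) (simp_all add: init_config_def assms)
  then show ?thesis
    by (simp add: measurable_config_def init_config_def)
qed

definition scan :: "config \<Rightarrow> nat \<times> nat \<times> bool \<times> bool \<times> bool" where
  "scan c = (st c, hd c, cell c (Inl (hd c)), cell c (Inr (Inl (hd c))), cell c (Inr (Inr (hd c))))"

lemma measurable_scan:
  assumes "measurable_config M c"
  shows "(\<lambda>w. scan (c w)) \<in> M \<rightarrow>\<^sub>M count_space UNIV"
proof -
  have c: "(\<lambda>w. st (c w)) \<in> M \<rightarrow>\<^sub>M count_space UNIV" "(\<lambda>w. hd (c w)) \<in> M \<rightarrow>\<^sub>M count_space UNIV"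
    "\<And>k. Measurable.pred M (\<lambda>w. cell (c w) k)"
    using assms by (simp_all add: measurable_config_def)
  have "Measurable.pred M (\<lambda>w. cell (c w) (\<kappa> (hd (c w))))" for \<kappa>
    using measurable_compose_countable[where f = "\<lambda>h w. cell (c w) (\<kappa> h)", OF c(3,2)] .
  then show ?thesis
    unfolding scan_def by (intro measurable_Pair_count_space c)
qed

lemma step_local:
  obtains q h where "\<And>c. st (step P c) = q (scan c)" "\<And>c. hd (step P c) = h (scan c)"
    "\<And>k. \<exists>i b. \<forall>c. cell (step P c) k = (if hd c = i then b (scan c) else cell c k)"
proof -
  define \<delta> where "\<delta> = (\<lambda>(q, h :: nat, x, y, z). delta P q x y z)"
  have step: "step P c = (case \<delta> (scan c) of (q, x, y, z, right) \<Rightarrow>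
      \<lparr>st = q, hd = if right then hd c + 1 else hd c - 1, inp = (inp c)(hd c := x),
       scr = (scr c)(hd c := y), out = (out c)(hd c := z)\<rparr>)" for c
    by (simp add: step_def \<delta>_def scan_def Let_def)
  show thesis
  proof
    show "st (step P c) = fst (\<delta> (scan c))" for c
      by (simp add: step case_prod_beta)
    show "hd (step P c) =
        (\<lambda>v. case (v, \<delta> v) of ((_, h, _), _, _, _, _, right) \<Rightarrow> if right then h + 1 else h - 1) (scan c)"
      for c
      by (simp add: step case_prod_beta) (simp add: scan_def)
    show "\<exists>i b. \<forall>c. cell (step P c) k = (if hd c = i then b (scan c) else cell c k)" for k
    proof (cases "(init_config (\<lambda>_. False), k)" rule: cell.cases)
      case (1 _ i)
      then show ?thesis
        by (intro exI[of _ i] exI[of _ "\<lambda>v. fst (snd (\<delta> v))"]) (simp add: step case_prod_beta)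
    next
      case (2 _ i)
      then show ?thesis
        by (intro exI[of _ i] exI[of _ "\<lambda>v. fst (snd (snd (\<delta> v)))"]) (simp add: step case_prod_beta)
    next
      case (3 _ i)
      then show ?thesis
        by (intro exI[of _ i] exI[of _ "\<lambda>v. fst (snd (snd (snd (\<delta> v))))"])
          (simp add: step case_prod_beta)
    qed
  qed
qed

lemma measurable_config_step:
  assumes c: "measurable_config M c"
  shows "measurable_config M (\<lambda>w. step P (c w))"
proof -
  obtain q h where local: "\<And>c. st (step P c) = q (scan c)" "\<And>c. hd (step P c) = h (scan c)"
    "\<And>k. \<exists>i b. \<forall>c. cell (step P c) k = (if hd c = i then b (scan c) else cell c k)"
    using step_local[of P] by metis
  have scanned: "(\<lambda>w. F (scan (c w))) \<in> M \<rightarrow>\<^sub>M count_space UNIV" for F :: "_ \<Rightarrow> 'b"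
    using measurable_scan[OF c] by (rule measurable_compose[OF _ measurable_count_space])
  have "Measurable.pred M (\<lambda>w. cell (step P (c w)) k)" for k
  proof -
    obtain i b where step_cell: "\<forall>c. cell (step P c) k = (if hd c = i then b (scan c) else cell c k)"
      using local(3) by blast
    have [measurable]: "(\<lambda>w. hd (c w)) \<in> M \<rightarrow>\<^sub>M count_space UNIV"
      "Measurable.pred M (\<lambda>w. cell (c w) k)" "Measurable.pred M (\<lambda>w. b (scan (c w)))"
      using c scanned[of b] by (simp_all add: measurable_config_def)
    have "Measurable.pred M (\<lambda>w. if hd (c w) = i then b (scan (c w)) else cell (c w) k)"
      by measurable
    then show ?thesis
      by (simp only: step_cell)
  qed
  then show ?thesis
    unfolding measurable_config_def local(1,2) using scanned by blast
qed

lemma measurable_config_run: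
  assumes "\<And>i. Measurable.pred M (\<lambda>w. input w i)" and "t \<in> omega1"
  shows "measurable_config M (\<lambda>w. run P (input w) t)"
  using \<open>t \<in> omega1\<close>
proof (induction t rule: less_induct)
  case (less t)
  note IH = less.IH[OF _ omega1_downward_closed[OF less.prems less_imp_le]]
  show ?case
  proof (cases t rule: stage_cases)
    case least
    then show ?thesis
      using measurable_config_init[OF assms(1)] by (simp add: run_least)
  next
    case (successor s)
    then show ?thesis
      using measurable_config_step[OF IH] by (simp add: run_successor[of s t])
  next
    case limit
    have "Measurable.pred M (\<lambda>w. \<forall>s\<in>{..<t}. \<exists>u\<in>{s..<t}. cell (run P (input w) u) k)" for k
    proof (intro pred_countable_bounded)
      show "countable {..<t}" "countable {s..<t}" for s
        using less.prems by (rule countable_below_omega1, auto)+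
      show "Measurable.pred M (\<lambda>w. cell (run P (input w) u) k)" if "u \<in> {s..<t}" for s u
        using IH[of u] that by (simp add: measurable_config_def)
    qed
    then show ?thesis
      using run_limit_simps[OF limit] by (simp add: measurable_config_def Ball_def Bex_def)
  qed
qed

lemma pred_halts_at:
  assumes input: "\<And>i. Measurable.pred M (\<lambda>w. input w i)" and "t \<in> omega1"
  shows "Measurable.pred M (\<lambda>w. halts_at P (input w) t)"
proof -
  have st: "(\<lambda>w. st (run P (input w) s)) \<in> M \<rightarrow>\<^sub>M count_space UNIV" if "s \<le> t" for s
    using measurable_config_run[where input = input, OF input omega1_downward_closed[OF assms(2) that]]
    unfolding measurable_config_def by blast
  have halted: "Measurable.pred M (\<lambda>w. st (run P (input w) s) = halt_state)" if "s \<le> t" for s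
    by (rule measurable_compose[OF st[OF that] measurable_count_space])
  have "countable {..<t}"
    using assms(2) by (rule countable_below_omega1) auto
  then have "Measurable.pred M (\<lambda>w. \<forall>s\<in>{..<t}. \<not> st (run P (input w) s) = halt_state)"
    by (rule pred_countable_bounded(1)) (rule pred_intros_logic(2), rule halted, auto)
  then show ?thesis
    using pred_intros_logic(3)[OF halted[OF order_refl]] unfolding halts_at_def by (simp add: Ball_def)
qed

subsection \<open>Generic halting times\<close>

lemma ex_dominating_stage:
  fixes Q :: "'k::countable \<Rightarrow> 't::wellorder \<Rightarrow> 'a::second_countable_topology \<Rightarrow> bool"
  assumes uncountable: "uncountable (UNIV :: 't set)" and "t \<in> omega1"
    and Q: "\<And>k u. u \<in> omega1 \<Longrightarrow> Measurable.pred baire_algebra (Q k u)"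
  shows "\<exists>t'. t' \<in> omega1 \<and> t < t' \<and>
    (\<forall>u\<in>omega1. t \<le> u \<longrightarrow> (\<forall>\<^sub>F w in comeager. \<forall>k. Q k u w \<longrightarrow> (\<exists>s\<in>{t..<t'}. Q k s w)))"
proof -
  obtain J where J: "J \<subseteq> omega1 \<inter> {t..}" "countable J"
    "\<forall>u\<in>omega1 \<inter> {t..}. \<forall>\<^sub>F w in comeager. \<forall>k. Q k u w \<longrightarrow> (\<exists>s\<in>J. Q k s w)"
    using countable_essential_union_family[of "omega1 \<inter> {t..}" Q] Q by blast
  have "countable (insert t J)" "insert t J \<subseteq> omega1"
    using J(1,2) \<open>t \<in> omega1\<close> by auto
  then obtain t' where t': "t' \<in> omega1" "\<And>s. s \<in> insert t J \<Longrightarrow> s < t'"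
    using omega1_strict_upper_bound[OF uncountable] by blast
  then have interval: "J \<subseteq> {t..<t'}"
    using J(1) by fastforce
  have "\<forall>\<^sub>F w in comeager. \<forall>k. Q k u w \<longrightarrow> (\<exists>s\<in>{t..<t'}. Q k s w)" if "u \<in> omega1" "t \<le> u" for u
  proof -
    have "\<forall>\<^sub>F w in comeager. \<forall>k. Q k u w \<longrightarrow> (\<exists>s\<in>J. Q k s w)"
      using J(3) that by simp
    then show ?thesis
      by eventually_elim (use interval in blast)
  qed
  then show ?thesis
    using t' by auto
qed

text \<open>At an absorbing stage the cells have reached, modulo meager sets of parameters, their limsup along
  the countable stages.\<close>

definition absorbing :: "prog \<Rightarrow> ('a::topological_space \<Rightarrow> cantor) \<Rightarrow> 't::wellorder \<Rightarrow> bool" where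
  "absorbing P input g \<longleftrightarrow> g \<in> omega1 \<and> is_limit g \<and>
     (\<forall>u\<in>omega1. g \<le> u \<longrightarrow>
       (\<forall>\<^sub>F w in comeager. \<forall>k. cell (run P (input w) u) k \<longrightarrow> cell (run P (input w) g) k))"

context
  fixes P :: prog and input :: "'a::second_countable_topology \<Rightarrow> cantor"
  assumes input: "\<And>i. Measurable.pred baire_algebra (\<lambda>w. input w i)"
begin

lemma pred_cell_run:
  "t \<in> omega1 \<Longrightarrow> Measurable.pred baire_algebra (\<lambda>w. cell (run P (input w) t) k)"
  using measurable_config_run[where input = input, OF input] unfolding measurable_config_def by blast

lemma ex_absorbing_stage:
  fixes t :: "'t::wellorder"
  assumes uncountable: "uncountable (UNIV :: 't set)" and "t \<in> omega1"
  obtains g where "absorbing P input g" "t < g"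
proof -
  let ?Q = "\<lambda>k (u::'t) w. cell (run P (input w) u) k"
  have "\<forall>t\<in>omega1. \<exists>t'. t' \<in> omega1 \<and> t < t' \<and>
      (\<forall>u\<in>omega1. t \<le> u \<longrightarrow> (\<forall>\<^sub>F w in comeager. \<forall>k. ?Q k u w \<longrightarrow> (\<exists>s\<in>{t..<t'}. ?Q k s w)))"
    by (intro ballI ex_dominating_stage[OF uncountable] pred_cell_run)
  from bchoice[OF this] obtain dom where dom: "\<forall>t\<in>omega1. dom t \<in> omega1 \<and> t < dom t \<and>
      (\<forall>u\<in>omega1. t \<le> u \<longrightarrow> (\<forall>\<^sub>F w in comeager. \<forall>k. ?Q k u w \<longrightarrow> (\<exists>s\<in>{t..<dom t}. ?Q k s w)))" ..
  obtain g where g: "g \<in> omega1" "t < g" "is_limit g" "\<And>s. s < g \<Longrightarrow> \<exists>u\<in>omega1. s \<le> u \<and> dom u < g"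
    using ex_limit_closed_under[OF uncountable assms(2), of dom] dom by blast
  have "\<forall>\<^sub>F w in comeager. \<forall>k. ?Q k u w \<longrightarrow> ?Q k g w" if u: "u \<in> omega1" "g \<le> u" for u
  proof -
    have "\<forall>\<^sub>F w in comeager. \<forall>k. ?Q k u w \<longrightarrow> (\<exists>x\<in>{s..<g}. ?Q k x w)" if "s < g" for s
    proof -
      obtain s' where s': "s' \<in> omega1" "s \<le> s'" "dom s' < g"
        using g(4)[OF \<open>s < g\<close>] by blast
      then have interval: "{s'..<dom s'} \<subseteq> {s..<g}"
        by auto
      have "s' \<le> u"
        using dom s'(1,3) u(2) by (meson less_imp_le less_trans order_trans)
      then have "\<forall>\<^sub>F w in comeager. \<forall>k. ?Q k u w \<longrightarrow> (\<exists>x\<in>{s'..<dom s'}. ?Q k x w)"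
        using dom s'(1) u(1) by blast
      then show ?thesis
        by eventually_elim (use interval in blast)
    qed
    moreover have "countable {..<g}"
      using g(1) by (rule countable_below_omega1) auto
    ultimately have "\<forall>\<^sub>F w in comeager. \<forall>s\<in>{..<g}. \<forall>k. ?Q k u w \<longrightarrow> (\<exists>x\<in>{s..<g}. ?Q k x w)"
      by (intro eventually_comeager_ball) auto
    then show ?thesis
      unfolding run_limit_simps(3)[OF g(3)]
      by eventually_elim (meson atLeastLessThan_iff lessThan_iff)
  qed
  then have "absorbing P input g"
    using g(1,3) unfolding absorbing_def by blast
  then show thesis
    using that g(2) by blast
qed

lemma ex_stable_absorbing_stage:
  assumes uncountable: "uncountable (UNIV :: 't::wellorder set)"
  obtains g :: "'t::wellorder" where "absorbing P input g"
    "\<forall>h::'t. absorbing P input h \<longrightarrow>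
      (\<forall>\<^sub>F w in comeager. \<forall>k. cell (run P (input w) g) k \<longrightarrow> cell (run P (input w) h) k)"
proof -
  let ?Q = "\<lambda>k (u::'t) w. cell (run P (input w) u) k"
  have "Measurable.pred baire_algebra (\<lambda>w. \<not> ?Q k g w)" if "g \<in> Collect (absorbing P input)" for g k
    using pred_cell_run[of g k] that by (auto simp: absorbing_def)
  then obtain J where J: "J \<subseteq> Collect (absorbing P input)" "countable J"
    "\<forall>h\<in>Collect (absorbing P input). \<forall>\<^sub>F w in comeager. \<forall>k. \<not> ?Q k h w \<longrightarrow> (\<exists>j\<in>J. \<not> ?Q k j w)"
    using countable_essential_union_family[of _ "\<lambda>k g w. \<not> ?Q k g w"] by blast
  have "J \<subseteq> omega1"
    using J(1) by (auto simp: absorbing_def)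
  then obtain t where t: "t \<in> omega1" "\<And>j. j \<in> J \<Longrightarrow> j < t"
    using omega1_strict_upper_bound[OF uncountable J(2)] by blast
  obtain g where g: "absorbing P input g" "t < g"
    using ex_absorbing_stage[OF uncountable t(1)] by blast
  have "\<forall>\<^sub>F w in comeager. \<forall>k. ?Q k g w \<longrightarrow> ?Q k j w" if "j \<in> J" for j
  proof -
    have "absorbing P input j" "j \<le> g" "g \<in> omega1"
      using J(1) that t(2)[OF that] g by (auto simp: absorbing_def)
    then show ?thesis
      unfolding absorbing_def by blast
  qed
  then have below_J: "\<forall>\<^sub>F w in comeager. \<forall>j\<in>J. \<forall>k. ?Q k g w \<longrightarrow> ?Q k j w"
    by (rule eventually_comeager_ball[OF J(2)])
  have stable: "\<forall>\<^sub>F w in comeager. \<forall>k. ?Q k g w \<longrightarrow> ?Q k h w" if "absorbing P input h" for h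
  proof -
    have "\<forall>\<^sub>F w in comeager. \<forall>k. \<not> ?Q k h w \<longrightarrow> (\<exists>j\<in>J. \<not> ?Q k j w)"
      using J(3) that by simp
    then show ?thesis
      using below_J by eventually_elim blast
  qed
  show thesis
    by (intro that[OF g(1)] allI impI stable)
qed

lemma ex_generic_loop:
  assumes uncountable: "uncountable (UNIV :: 't::wellorder set)"
  obtains g h :: "'t::wellorder" where "h \<in> omega1" "is_limit g" "g < h"
    "\<forall>\<^sub>F w in comeager. run P (input w) h = run P (input w) g \<and>
       (\<forall>u\<in>{g..<h}. \<forall>k. cell (run P (input w) u) k \<longrightarrow> cell (run P (input w) g) k)"
proof -
  let ?Q = "\<lambda>k (u::'t) w. cell (run P (input w) u) k"
  obtain g :: 't where g: "absorbing P input g"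
    and stable: "\<forall>h. absorbing P input h \<longrightarrow> (\<forall>\<^sub>F w in comeager. \<forall>k. ?Q k g w \<longrightarrow> ?Q k h w)"
    by (rule ex_stable_absorbing_stage[OF uncountable])
  then have "g \<in> omega1" "is_limit g"
    by (simp_all add: absorbing_def)
  obtain h where h: "absorbing P input h" "g < h"
    using ex_absorbing_stage[OF uncountable \<open>g \<in> omega1\<close>] by blast
  then have "h \<in> omega1" "is_limit h"
    by (simp_all add: absorbing_def)
  have "\<forall>\<^sub>F w in comeager. \<forall>k. ?Q k u w \<longrightarrow> ?Q k g w" if "u \<in> {g..h}" for u
    using g omega1_downward_closed[OF \<open>h \<in> omega1\<close>] that unfolding absorbing_def by simp
  moreover have "countable {g..h}"
    using \<open>h \<in> omega1\<close> by (rule countable_below_omega1) auto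
  ultimately have "\<forall>\<^sub>F w in comeager. \<forall>u\<in>{g..h}. \<forall>k. ?Q k u w \<longrightarrow> ?Q k g w"
    by (intro eventually_comeager_ball)
  then have "\<forall>\<^sub>F w in comeager. run P (input w) h = run P (input w) g \<and>
       (\<forall>u\<in>{g..<h}. \<forall>k. ?Q k u w \<longrightarrow> ?Q k g w)"
    using stable[rule_format, OF h(1)]
  proof eventually_elim
    case (elim w)
    have "run P (input w) h = run P (input w) g"
    proof (rule config_eqI)
      show "st (run P (input w) h) = st (run P (input w) g)"
        "hd (run P (input w) h) = hd (run P (input w) g)"
        by (simp_all add: run_limit_simps \<open>is_limit g\<close> \<open>is_limit h\<close>)
      show "?Q k h w = ?Q k g w" for k
        using elim h(2) by (meson atLeastAtMost_iff less_imp_le order_refl)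
    qed
    then show ?case
      using elim(1) by (metis atLeastAtMost_iff atLeastLessThan_iff less_imp_le)
  qed
  then show thesis
    by (rule that[OF \<open>h \<in> omega1\<close> \<open>is_limit g\<close> h(2)])
qed

theorem generic_halting_time_bounded:
  assumes uncountable: "uncountable (UNIV :: 't::wellorder set)"
  obtains h :: "'t::wellorder" where "h \<in> omega1" "\<forall>\<^sub>F w in comeager. \<forall>t. halts_at P (input w) t \<longrightarrow> t < h"
proof -
  obtain g h :: 't where h: "h \<in> omega1" "is_limit g" "g < h"
    and loop: "\<forall>\<^sub>F w in comeager. run P (input w) h = run P (input w) g \<and>
       (\<forall>u\<in>{g..<h}. \<forall>k. cell (run P (input w) u) k \<longrightarrow> cell (run P (input w) g) k)"
    by (rule ex_generic_loop[OF uncountable])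
  from loop have "\<forall>\<^sub>F w in comeager. \<forall>t. halts_at P (input w) t \<longrightarrow> t < h"
  proof eventually_elim
    case (elim w)
    have "t < h" if "halts_at P (input w) t" for t
    proof (rule ccontr)
      assume "\<not> t < h"
      then have "g \<le> t"
        using h(3) by simp
      then obtain x where "x < h" "run P (input w) t = run P (input w) x"
        using run_loop[OF h(2,3)] elim by (metis atLeastLessThan_iff)
      then show False
        using that \<open>\<not> t < h\<close> unfolding halts_at_def by (metis less_le_trans not_less)
    qed
    then show ?case
      by blast
  qed
  then show thesis
    using that h(1) by blast
qed

end

subsection \<open>Category measurability of computable functions\<close>

text \<open>Every well-order on \<^typ>\<open>nat set\<close>, hence the time line of every halting computation, embeds in
  this type.\<close>

typedef stage = "UNIV :: nat set set set" ..

instantiation stage :: wellorder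
begin

definition less_eq_stage :: "stage \<Rightarrow> stage \<Rightarrow> bool" where
  "s \<le> t \<longleftrightarrow> (s, t) \<in> |UNIV :: stage set|"

definition less_stage :: "stage \<Rightarrow> stage \<Rightarrow> bool" where
  "(s::stage) < t \<longleftrightarrow> s \<le> t \<and> s \<noteq> t"

instance
proof
  let ?r = "|UNIV :: stage set|"
  have "well_order_on UNIV ?r"
    by (rule card_of_well_order_on)
  then have r: "refl ?r" "trans ?r" "antisym ?r" "total ?r" "wf (?r - Id)"
    unfolding well_order_on_def linear_order_on_def partial_order_on_def preorder_on_def by auto
  fix s t u :: stage
  show "s < t \<longleftrightarrow> s \<le> t \<and> \<not> t \<le> s"
    using r(1,3) unfolding less_stage_def less_eq_stage_def by (auto dest: antisymD reflD)
  show "s \<le> s"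
    using r(1) unfolding less_eq_stage_def by (rule reflD)
  show "s \<le> t \<Longrightarrow> t \<le> u \<Longrightarrow> s \<le> u"
    using r(2) unfolding less_eq_stage_def by (rule transD)
  show "s \<le> t \<Longrightarrow> t \<le> s \<Longrightarrow> s = t"
    using r(3) unfolding less_eq_stage_def by (rule antisymD)
  show "s \<le> t \<or> t \<le> s"
    using r(1,4) unfolding less_eq_stage_def total_on_def by (metis UNIV_I reflD)
  show "Q t" if "\<And>x. (\<And>y. y < x \<Longrightarrow> Q y) \<Longrightarrow> Q x" for Q
    using r(5)
    by (induction t rule: wf_induct_rule) (auto intro: that simp: less_stage_def less_eq_stage_def)
qed

end

lemma card_nat_set_less_stage: "|UNIV :: nat set set| <o |UNIV :: stage set|"
proof -
  have "bij_betw Rep_stage UNIV (UNIV :: nat set set set)"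
    by (intro bij_betwI[where g = Abs_stage]) (auto simp: Rep_stage_inverse Abs_stage_inverse)
  then have "|UNIV :: nat set set set| =o |UNIV :: stage set|"
    using card_of_ordIsoI ordIso_symmetric by blast
  then show ?thesis
    using card_of_Pow[of "UNIV :: nat set set"] by (simp add: ordLess_ordIso_trans)
qed

lemma card_nat_less_stage: "|UNIV :: nat set| <o |UNIV :: stage set|"
  using ordLess_transitive[OF card_of_Pow[of "UNIV :: nat set"]] card_nat_set_less_stage by simp

lemma uncountable_UNIV_stage: "uncountable (UNIV :: stage set)"
proof
  assume "countable (UNIV :: stage set)"
  then have "|UNIV :: stage set| \<le>o |UNIV :: nat set|"
    unfolding countable_def card_of_ordLeq[symmetric] by auto
  then show False
    using card_nat_less_stage not_ordLess_ordLeq by blast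
qed

theorem category_measurable_halting_output:
  assumes input: "\<And>i. Measurable.pred baire_algebra (\<lambda>w::'a::second_countable_topology. input w i)"
    and halts: "\<And>w. halts_with P (input w) (F w)"
  shows "Measurable.pred baire_algebra (\<lambda>w. F w i)"
proof -
  obtain h :: stage where h: "h \<in> omega1" "\<forall>\<^sub>F w in comeager. \<forall>t. halts_at P (input w) t \<longrightarrow> t < h"
    using generic_halting_time_bounded[where input = input, OF input uncountable_UNIV_stage] by metis
  define F' where
    "F' w \<longleftrightarrow> (\<exists>t\<in>{..<h}. halts_at P (input w) t \<and> cell (run P (input w) t) (Inr (Inr i)))" for w
  have "F w i \<longleftrightarrow> F' w" if "\<forall>t. halts_at P (input w) t \<longrightarrow> t < h" for w
  proof -
    obtain t :: stage where "halts_at P (input w) t" "out (run P (input w) t) = F w"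
      using halts_with_imp_halts_at[OF halts card_nat_set_less_stage] by blast
    then show ?thesis
      unfolding F'_def using that by (auto dest: halts_at_unique)
  qed
  then have generic_eq: "\<forall>\<^sub>F w in comeager. F w i \<longleftrightarrow> F' w"
    using h(2) by (auto elim: eventually_mono)
  have "Measurable.pred baire_algebra F'"
    unfolding F'_def
  proof (intro pred_countable_bounded pred_intros_logic)
    show "countable {..<h}"
      using h(1) by (rule countable_below_omega1) auto
    fix t assume "t \<in> {..<h}"
    then have "t \<in> omega1"
      using omega1_downward_closed[OF h(1)] by auto
    then show "Measurable.pred baire_algebra (\<lambda>w. halts_at P (input w) t)"
      "Measurable.pred baire_algebra (\<lambda>w. cell (run P (input w) t) (Inr (Inr i)))"
      using pred_halts_at[where input = input, OF input] pred_cell_run[where input = input, OF input]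
      by blast+
  qed
  then show ?thesis
    by (simp only: pred_baire_algebra_cong[OF generic_eq])
qed

theorem category_measurable_itt_computable:
  fixes code :: "'a::second_countable_topology \<Rightarrow> cantor"
  assumes f: "itt_computable_on X f" and X: "\<And>w. code w \<in> X"
    and code: "\<And>i. Measurable.pred baire_algebra (\<lambda>w. code w i)"
  shows "Measurable.pred baire_algebra (\<lambda>w. f (code w) i)"
proof -
  obtain P z where P: "\<And>x. x \<in> X \<Longrightarrow> halts_with P (join x z) (f x)"
    using f unfolding itt_computable_on_def by blast
  have "Measurable.pred baire_algebra (\<lambda>w. join (code w) z i)" for i
    by (cases "even i") (simp_all add: join_def code)
  then show ?thesis
    by (rule category_measurable_halting_output) (rule P[OF X])
qed

section \<open>Generic reals\<close>

lemma pred_bit [measurable]: "Measurable.pred baire_algebra (\<lambda>x::cantor. x i)"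
  by (intro measurable_baire_algebra_continuous) simp

lemma eventually_comeager_neq: "\<forall>\<^sub>F y in comeager. y \<noteq> (x::cantor)"
proof -
  have "open ((\<lambda>y. y i) -` {b. b \<noteq> x i})" for i
    by (rule open_vimage[OF open_discrete]) simp
  then have "open (\<Union>i. (\<lambda>y. y i) -` {b. b \<noteq> x i})"
    by blast
  moreover have "\<exists>y\<in>W. y \<in> (\<Union>i. (\<lambda>y. y i) -` {b. b \<noteq> x i})" if "open W" "W \<noteq> {}" for W :: "cantor set"
  proof -
    obtain w where "w \<in> W"
      using \<open>W \<noteq> {}\<close> by blast
    then obtain n where "\<forall>y. (\<forall>i<n. y i = w i) \<longrightarrow> y \<in> W"
      using open_fun_prefix[OF \<open>open W\<close>] by blast
    then have "w(n := \<not> x n) \<in> W"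
      by simp
    moreover have "w(n := \<not> x n) \<in> (\<lambda>y. y n) -` {b. b \<noteq> x n}"
      by simp
    ultimately show ?thesis
      by blast
  qed
  ultimately have "\<forall>\<^sub>F y in comeager. y \<in> (\<Union>i. (\<lambda>y. y i) -` {b. b \<noteq> x i})"
    by (rule eventually_comeager_open_dense)
  then show ?thesis
    by eventually_elim auto
qed

definition flip_bits :: "nat set \<Rightarrow> cantor \<Rightarrow> cantor" where
  "flip_bits S x i \<longleftrightarrow> x i \<noteq> (i \<in> S)"

lemma flip_bits_flip_bits: "flip_bits S (flip_bits S x) = x"
  by (auto simp: flip_bits_def fun_eq_iff)

lemma continuous_on_flip_bits: "continuous_on UNIV (flip_bits S)"
proof (rule continuous_on_coordinatewise_then_product)
  show "continuous_on UNIV (\<lambda>x. flip_bits S x i)" for i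
    unfolding flip_bits_def by (rule continuous_on_compose2[of UNIV "\<lambda>b. b \<noteq> (i \<in> S)"]) simp_all
qed

lemma E0_iff_flip_bits: "E0 x y \<longleftrightarrow> (\<exists>S. finite S \<and> y = flip_bits S x)"
proof
  assume "E0 x y"
  moreover have "y = flip_bits {i. x i \<noteq> y i} x"
    by (auto simp: flip_bits_def)
  ultimately show "\<exists>S. finite S \<and> y = flip_bits S x"
    unfolding E0_def by blast
next
  assume "\<exists>S. finite S \<and> y = flip_bits S x"
  then obtain S where "finite S" "y = flip_bits S x"
    by blast
  then show "E0 x y"
    unfolding E0_def by (elim rev_finite_subset) (auto simp: flip_bits_def)
qed

lemma E0_refl: "E0 x x"
  by (simp add: E0_def)

lemma eventually_comeager_not_E0: "\<forall>\<^sub>F y in comeager. \<not> E0 x y"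
proof -
  have "\<forall>\<^sub>F y in comeager. \<forall>S\<in>{S. finite S}. y \<noteq> flip_bits S x"
    by (intro eventually_comeager_ball countable_Collect_finite eventually_comeager_neq)
  then show ?thesis
    by eventually_elim (auto simp: E0_iff_flip_bits)
qed

lemma E0_zero_one_law:
  assumes "Measurable.pred baire_algebra Q" and invariant: "\<And>x y. E0 x y \<Longrightarrow> Q y \<Longrightarrow> Q x"
  shows "(\<forall>\<^sub>F x in comeager. Q x) \<or> (\<forall>\<^sub>F x in comeager. \<not> Q x)"
proof (rule topological_zero_one_law[where \<Gamma> = "flip_bits ` {S. finite S}"])
  show "countable (flip_bits ` {S. finite S})"
    by (intro countable_image countable_Collect_finite)
  show "filterlim \<gamma> comeager comeager" if "\<gamma> \<in> flip_bits ` {S. finite S}" for \<gamma>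
    using that filterlim_comeager_involution[OF continuous_on_flip_bits flip_bits_flip_bits] by blast
  show "\<forall>\<^sub>F x in comeager. \<exists>\<gamma>\<in>flip_bits ` {S. finite S}. \<gamma> x \<in> U" if U: "open U" "U \<noteq> {}" for U
  proof (rule always_eventually, rule allI)
    fix x
    obtain y where "y \<in> U"
      using U(2) by blast
    then obtain n where n: "\<forall>z. (\<forall>i<n. z i = y i) \<longrightarrow> z \<in> U"
      using open_fun_prefix[OF U(1)] by blast
    define S where "S = {i. i < n \<and> x i \<noteq> y i}"
    have "\<forall>i<n. flip_bits S x i = y i"
      by (auto simp: flip_bits_def S_def)
    then have "flip_bits S x \<in> U"
      using n by blast
    moreover have "finite S"
      by (simp add: S_def)
    ultimately show "\<exists>\<gamma>\<in>flip_bits ` {S. finite S}. \<gamma> x \<in> U"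
      by blast
  qed
  show "Q x" if "\<gamma> \<in> flip_bits ` {S. finite S}" "Q (\<gamma> x)" for \<gamma> x
    using that invariant E0_iff_flip_bits by blast
qed (rule assms(1))

section \<open>\<open>E0\<close> and equality\<close>

theorem E0_not_reducible_to_equality: "\<not> itt_reducible E0 UNIV (=) UNIV"
proof
  assume "itt_reducible E0 UNIV (=) UNIV"
  then obtain f where f: "itt_computable_on UNIV f" "\<And>x y. E0 x y \<longleftrightarrow> f x = f y"
    unfolding itt_reducible_def by auto
  have "\<exists>b. \<forall>\<^sub>F x in comeager. f x i = b" for i
  proof -
    have "Measurable.pred baire_algebra (\<lambda>x. f x i)"
      using category_measurable_itt_computable[OF f(1) UNIV_I pred_bit] .
    then have "(\<forall>\<^sub>F x in comeager. f x i) \<or> (\<forall>\<^sub>F x in comeager. \<not> f x i)"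
      using f(2) by (intro E0_zero_one_law) auto
    then show ?thesis
      by (simp add: ex_bool_eq)
  qed
  then obtain v where "\<And>i. \<forall>\<^sub>F x in comeager. f x i = v i"
    by metis
  then have generic_value: "\<forall>\<^sub>F x in comeager. \<forall>i. f x i = v i"
    by (rule eventually_comeager_all)
  then obtain x where x: "\<forall>i. f x i = v i"
    using eventually_happens'[OF comeager_neq_bot] by blast
  obtain y where "\<forall>i. f y i = v i" "\<not> E0 x y"
    using eventually_happens'[OF comeager_neq_bot eventually_conj[OF generic_value eventually_comeager_not_E0]]
    by blast
  then show False
    using x f(2) by (simp add: fun_eq_iff)
qed

section \<open>Well-orders and hereditarily countable sets\<close>

definition rank_le :: "'b rel \<Rightarrow> ('b \<Rightarrow> 't::wellorder) \<Rightarrow> 'b \<Rightarrow> 't \<Rightarrow> bool" where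
  "rank_le r f n t \<longleftrightarrow> (n \<in> Field r \<longrightarrow> f n \<le> t)"

lemma image_underS_le:
  assumes "Well_order r" "embed r {(s, t). s \<le> (t::'t::wellorder)} f" "n \<in> Field r"
  shows "f ` underS r n = {..<f n}"
  using image_underS[OF assms(1) Well_order_le assms(2,3)] by (simp add: underS_le)

lemma rank_le_rec:
  assumes "Well_order r" "embed r {(s, t). s \<le> (t::'t::wellorder)} f"
  shows "rank_le r f n t \<longleftrightarrow> (\<forall>m. m \<in> underS r n \<longrightarrow> (\<exists>s\<in>{..<t}. rank_le r f m s))"
proof (cases "n \<in> Field r")
  case True
  have "f n \<le> t \<longleftrightarrow> (\<forall>x\<in>{..<f n}. \<exists>s\<in>{..<t}. x \<le> s)"
    by (metis (full_types) lessThan_iff less_le_trans not_less order_refl)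
  also have "\<dots> \<longleftrightarrow> (\<forall>m\<in>underS r n. \<exists>s\<in>{..<t}. rank_le r f m s)"
    unfolding image_underS_le[OF assms True, symmetric] rank_le_def
    using Order_Relation.underS_Field[of r n] by auto
  finally show ?thesis
    using True by (auto simp: rank_le_def)
next
  case False
  then show ?thesis
    using underS_empty[OF False] by (simp add: rank_le_def)
qed

context
  fixes \<rho> :: "'a::second_countable_topology \<Rightarrow> nat rel" and f :: "'a \<Rightarrow> nat \<Rightarrow> 't::wellorder"
  assumes wo: "\<And>w. Well_order (\<rho> w)" and emb: "\<And>w. embed (\<rho> w) {(s, t). s \<le> t} (f w)"
    and measurable: "\<And>m n. Measurable.pred baire_algebra (\<lambda>w. (m, n) \<in> \<rho> w)"
begin

lemma pred_rank_le: "t \<in> omega1 \<Longrightarrow> Measurable.pred baire_algebra (\<lambda>w. rank_le (\<rho> w) (f w) n t)"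
proof (induction t arbitrary: n rule: less_induct)
  case (less t)
  have "countable {..<t}"
    using less.prems by (rule countable_below_omega1) auto
  moreover have "Measurable.pred baire_algebra (\<lambda>w. rank_le (\<rho> w) (f w) m s)" if "s \<in> {..<t}" for m s
    using less.IH[of s m] omega1_downward_closed[OF less.prems] that by simp
  ultimately have "Measurable.pred baire_algebra (\<lambda>w. \<exists>s\<in>{..<t}. rank_le (\<rho> w) (f w) m s)" for m
    by (rule pred_countable_bounded(2))
  moreover have "Measurable.pred baire_algebra (\<lambda>w. m \<in> underS (\<rho> w) n)" for m
    using measurable[of m n] by (cases "m = n") (simp_all add: underS_def)
  ultimately show ?case
    unfolding rank_le_rec[OF wo emb, of _ n t] by measurable
qed

lemma generic_embedding_bounded:
  assumes uncountable: "uncountable (UNIV :: 't set)"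
  obtains t where "t \<in> omega1" "\<forall>\<^sub>F w in comeager. f w ` Field (\<rho> w) \<subseteq> {..t}"
proof -
  let ?Q = "\<lambda>n t w. rank_le (\<rho> w) (f w) n t"
  obtain J where J: "J \<subseteq> omega1" "countable J"
    "\<forall>t\<in>omega1. \<forall>\<^sub>F w in comeager. \<forall>n. ?Q n t w \<longrightarrow> (\<exists>j\<in>J. ?Q n j w)"
    using countable_essential_union_family[of omega1 ?Q] pred_rank_le by blast
  obtain t where t: "t \<in> omega1" "\<And>j. j \<in> J \<Longrightarrow> j < t"
    using omega1_strict_upper_bound[OF uncountable J(2,1)] by blast
  obtain t' where t': "t' \<in> omega1" "t < t'"
    using omega1_strict_upper_bound[OF uncountable, of "{t}"] t(1) by auto
  have "\<forall>\<^sub>F w in comeager. \<forall>n. ?Q n t' w \<longrightarrow> (\<exists>j\<in>J. ?Q n j w)"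
    using J(3) t'(1) by blast
  then have "\<forall>\<^sub>F w in comeager. f w ` Field (\<rho> w) \<subseteq> {..t}"
  proof eventually_elim
    case (elim w)
    have "?Q n t w" for n
    proof (induction "f w n" arbitrary: n rule: less_induct)
      case less
      have "?Q m t w" if "m \<in> underS (\<rho> w) n" for m
      proof (rule less.hyps)
        show "f w m < f w n"
          using image_underS_le[OF wo emb, of n w] that underS_empty[of n "\<rho> w"] by blast
      qed
      then have "?Q n t' w"
        unfolding rank_le_rec[OF wo emb, of w n t'] using t'(2) by blast
      then obtain j where "j \<in> J" "?Q n j w"
        using elim by blast
      then show ?case
        using t(2) unfolding rank_le_def by (meson less_imp_le order_trans)
    qed
    then show ?case
      by (auto simp: rank_le_def)
  qed
  then show thesis
    using that t(1) by blast
qed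

end

lemma generic_order_types_countable:
  fixes \<rho> :: "'a::second_countable_topology \<Rightarrow> nat rel"
  assumes wo: "\<And>w. Well_order (\<rho> w)"
    and measurable: "\<And>m n. Measurable.pred baire_algebra (\<lambda>w. (m, n) \<in> \<rho> w)"
  obtains \<T> :: "stage rel set" where "countable \<T>" "\<forall>\<^sub>F w in comeager. \<exists>r\<in>\<T>. \<rho> w =o r"
proof -
  let ?le = "{(s, t). s \<le> (t::stage)}"
  have "\<exists>f. embed (\<rho> w) ?le f" for w
  proof -
    have "|Field (\<rho> w)| <o |UNIV :: stage set|"
      using card_of_mono1[of "Field (\<rho> w)" UNIV] card_nat_less_stage by (auto intro: ordLeq_ordLess_trans)
    then show ?thesis
      using ex_embed_of_card_less[OF wo] by blast
  qed
  then obtain f where emb: "\<And>w. embed (\<rho> w) ?le (f w)"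
    by metis
  obtain t where t: "t \<in> omega1" "\<forall>\<^sub>F w in comeager. f w ` Field (\<rho> w) \<subseteq> {..t}"
    using generic_embedding_bounded[OF wo emb measurable uncountable_UNIV_stage] by blast
  define \<T> where "\<T> = (\<lambda>A. Restr ?le A) ` {A. A \<subseteq> {..t} \<and> (\<forall>s\<in>A. {..s} \<subseteq> A)}"
  have "countable \<T>"
    unfolding \<T>_def by (intro countable_image countable_lower_sets_below t(1))
  moreover have "\<forall>\<^sub>F w in comeager. \<exists>r\<in>\<T>. \<rho> w =o r"
    using t(2)
  proof eventually_elim
    case (elim w)
    let ?A = "f w ` Field (\<rho> w)"
    have "ofilter ?le ?A"
      by (rule embed_Field_ofilter[OF wo Well_order_le emb])
    moreover have "under ?le s = {..s}" for s
      by (auto simp: under_def)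
    ultimately have "Restr ?le ?A \<in> \<T>"
      using elim unfolding \<T>_def by (auto simp: ofilter_def)
    moreover have "\<rho> w =o Restr ?le ?A"
      unfolding ordIso_def
      using embed_implies_iso_Restr[OF Well_order_le wo emb] wo Well_order_Restr[OF Well_order_le] by blast
    ultimately show ?case
      by blast
  qed
  ultimately show thesis
    by (rule that)
qed

theorem not_reducible_to_iso_WO:
  fixes code :: "cantor \<Rightarrow> cantor"
  assumes X: "\<And>x. code x \<in> X" and code: "\<And>i. Measurable.pred baire_algebra (\<lambda>x. code x i)"
    and inj: "\<And>x y. E (code x) (code y) \<Longrightarrow> x = y"
  shows "\<not> itt_reducible E X iso_WO WO"
proof
  assume "itt_reducible E X iso_WO WO"
  then obtain f where f: "\<And>x. x \<in> X \<Longrightarrow> f x \<in> WO" "itt_computable_on X f"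
    "\<And>x y. x \<in> X \<Longrightarrow> y \<in> X \<Longrightarrow> E x y \<longleftrightarrow> iso_WO (f x) (f y)"
    unfolding itt_reducible_def by auto
  define \<rho> where "\<rho> x = coded_rel (f (code x))" for x
  have "Well_order (\<rho> x)" for x
    using f(1)[OF X] by (simp add: WO_def \<rho>_def)
  moreover have "Measurable.pred baire_algebra (\<lambda>x. (m, n) \<in> \<rho> x)" for m n
    using category_measurable_itt_computable[OF f(2) X code] by (simp add: \<rho>_def coded_rel_def)
  ultimately obtain \<T> :: "stage rel set"
    where \<T>: "countable \<T>" "\<forall>\<^sub>F x in comeager. \<exists>r\<in>\<T>. \<rho> x =o r"
    using generic_order_types_countable by blast
  have unique: "x = y" if "\<rho> x =o r" "\<rho> y =o r" for x y and r :: "stage rel"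
  proof -
    have "\<rho> x =o \<rho> y"
      using that ordIso_symmetric ordIso_transitive by blast
    then show ?thesis
      using inj f(3)[OF X X] by (simp add: iso_WO_def \<rho>_def)
  qed
  have "\<forall>\<^sub>F x in comeager. \<not> \<rho> x =o r" for r :: "stage rel"
  proof (cases "\<exists>y. \<rho> y =o r")
    case True
    then obtain y where "\<rho> y =o r"
      by blast
    with eventually_comeager_neq[of y] show ?thesis
      by (auto elim!: eventually_mono dest: unique)
  qed simp
  then have "\<forall>\<^sub>F x in comeager. \<forall>r\<in>\<T>. \<not> \<rho> x =o r"
    by (intro eventually_comeager_ball \<T>(1))
  then show False
    using eventually_happens'[OF comeager_neq_bot eventually_conj[OF \<T>(2)]] by blast
qed

theorem Eset_not_reducible_to_iso_WO: "\<not> itt_reducible Eset UNIV iso_WO WO"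
proof (rule not_reducible_to_iso_WO[where code = "\<lambda>x m. x (snd (prod_decode m))"])
  have "range (seq_entry (\<lambda>m. x (snd (prod_decode m)))) = {x}" for x
    by (auto simp: seq_entry_def)
  then show "x = y" if "Eset (\<lambda>m. x (snd (prod_decode m))) (\<lambda>m. y (snd (prod_decode m)))" for x y
    using that unfolding Eset_def by simp
qed (simp_all add: pred_bit)

text \<open>The hereditarily countable set \<open>\<omega> \<union> {a}\<close> with \<open>a = {1} \<union> {n + 2 | x n}\<close>: the code \<open>0\<close> stands
  for \<open>a\<close> and the code \<open>n + 1\<close> for the ordinal \<open>n\<close>.  As \<open>a\<close> is nonempty and omits \<open>0\<close>, it is never an
  ordinal.\<close>

definition omega_with_set :: "cantor \<Rightarrow> nat rel" where
  "omega_with_set x = {(i, j). if j = 0 then i = 2 \<or> (3 \<le> i \<and> x (i - 3)) else i \<noteq> 0 \<and> i < j}"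

lemma omega_with_set_zero: "(i, 0) \<in> omega_with_set x \<longleftrightarrow> i = 2 \<or> (3 \<le> i \<and> x (i - 3))"
  by (simp add: omega_with_set_def)

lemma omega_with_set_ordinal: "j \<noteq> 0 \<Longrightarrow> (i, j) \<in> omega_with_set x \<longleftrightarrow> i \<noteq> 0 \<and> i < j"
  by (simp add: omega_with_set_def)

lemma wf_omega_with_set: "wf (omega_with_set x)"
proof (rule wf_subset)
  show "wf (inv_image (less_than <*lex*> less_than)
      (\<lambda>k::nat. if k = 0 then (1::nat, 0::nat) else (0, k)))"
    by (intro wf_inv_image wf_lex_prod wf_less_than)
qed (auto simp: omega_with_set_def split: if_splits)

lemma omega_with_set_extensional:
  assumes same: "\<And>k. (k, m) \<in> omega_with_set x \<longleftrightarrow> (k, n) \<in> omega_with_set x"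
  shows "m = n"
proof -
  have not_ordinal: False if "j \<noteq> 0" "\<And>k. (k, 0) \<in> omega_with_set x \<longleftrightarrow> (k, j) \<in> omega_with_set x" for j
    using that(1) that(2)[of 1] that(2)[of 2] by (simp add: omega_with_set_zero omega_with_set_ordinal)
  show ?thesis
  proof (cases "m = 0 \<or> n = 0")
    case True
    then show ?thesis
      using not_ordinal[of m] not_ordinal[of n] same by metis
  next
    case False
    then show ?thesis
      using same[of m] same[of n] by (auto simp: omega_with_set_ordinal)
  qed
qed

lemma omega_with_set_rigid:
  assumes F: "bij F" and iso: "\<And>m n. (m, n) \<in> omega_with_set x \<longleftrightarrow> (F m, F n) \<in> omega_with_set y"
  shows "x = y"
proof -
  have inj: "F m = F n \<longleftrightarrow> m = n" for m n
    using F by (meson bij_def inj_eq)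
  have fixed: "F j = j" if "j \<noteq> 0" for j
    using that
  proof (induction j rule: less_induct)
    case (less j)
    show ?case
    proof (rule omega_with_set_extensional[of _ y])
      fix k
      obtain k' where k': "k = F k'"
        using F by (meson bij_pointE)
      have "(k, F j) \<in> omega_with_set y \<longleftrightarrow> k' \<noteq> 0 \<and> k' < j"
        using iso[of k' j] k' less.prems by (simp add: omega_with_set_ordinal)
      also have "\<dots> \<longleftrightarrow> k \<noteq> 0 \<and> k < j"
        using less.IH[of k'] less.IH[of k] inj[of k k'] k' by auto
      also have "\<dots> \<longleftrightarrow> (k, j) \<in> omega_with_set y"
        using less.prems by (simp add: omega_with_set_ordinal)
      finally show "(k, F j) \<in> omega_with_set y \<longleftrightarrow> (k, j) \<in> omega_with_set y" .
    qed
  qed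
  have "F 0 = 0"
    using fixed[of "F 0"] inj[of "F 0" 0] by auto
  show ?thesis
  proof
    show "x i = y i" for i
      using iso[of "i + 3" 0] fixed[of "i + 3"] \<open>F 0 = 0\<close> by (simp add: omega_with_set_zero)
  qed
qed

theorem iso_HC_not_reducible_to_iso_WO: "\<not> itt_reducible iso_HC HC iso_WO WO"
proof (rule not_reducible_to_iso_WO[where code = "\<lambda>x m. prod_decode m \<in> omega_with_set x"])
  have coded: "coded_rel (\<lambda>m. prod_decode m \<in> omega_with_set x) = omega_with_set x" for x
    by (auto simp: coded_rel_def)
  show "(\<lambda>m. prod_decode m \<in> omega_with_set x) \<in> HC" for x
    unfolding HC_def mem_Collect_eq coded using wf_omega_with_set omega_with_set_extensional by blast
  show "x = y"
    if "iso_HC (\<lambda>m. prod_decode m \<in> omega_with_set x) (\<lambda>m. prod_decode m \<in> omega_with_set y)" for x y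
    using that omega_with_set_rigid unfolding iso_HC_def coded by blast
  show "Measurable.pred baire_algebra (\<lambda>x. prod_decode m \<in> omega_with_set x)" for m
  proof -
    obtain i j where ij: "prod_decode m = (i, j)"
      by fastforce
    show ?thesis
    proof (cases "j = 0")
      case True
      then show ?thesis
        unfolding ij by (simp only: omega_with_set_zero) measurable
    next
      case False
      then show ?thesis
        unfolding ij by (simp add: omega_with_set_ordinal)
    qed
  qed
qed

section \<open>Countable sets of reals\<close>

subsection \<open>Generic enumerations\<close>

lemma eventually_comeager_surj: "\<forall>\<^sub>F h in comeager. surj (h :: nat \<Rightarrow> nat)"
proof -
  have "\<forall>\<^sub>F h in comeager. h \<in> {h :: nat \<Rightarrow> nat. c \<in> range h}" for c
  proof (rule eventually_comeager_open_dense)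
    have "open ((\<lambda>h :: nat \<Rightarrow> nat. h n) -` {c})" for n
      by (rule open_vimage[OF open_discrete]) simp
    then have "open (\<Union>n. (\<lambda>h :: nat \<Rightarrow> nat. h n) -` {c})"
      by blast
    moreover have "(\<Union>n. (\<lambda>h :: nat \<Rightarrow> nat. h n) -` {c}) = {h. c \<in> range h}"
      by auto
    ultimately show "open {h :: nat \<Rightarrow> nat. c \<in> range h}"
      by simp
    fix W :: "(nat \<Rightarrow> nat) set" assume "open W" "W \<noteq> {}"
    then obtain l where "cylinder l \<subseteq> W"
      using ex_cylinder_subset_open by blast
    define h where "h i = (if i < length l then l ! i else c)" for i
    have "h \<in> cylinder l"
      by (simp add: cylinder_def h_def)
    moreover have "h (length l) = c"
      by (simp add: h_def)
    then have "c \<in> range h"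
      by (metis rangeI)
    ultimately show "\<exists>h\<in>W. h \<in> {h. c \<in> range h}"
      using \<open>cylinder l \<subseteq> W\<close> by (intro bexI[of _ h]) auto
  qed
  then have "\<forall>\<^sub>F h in comeager. \<forall>c. h \<in> {h :: nat \<Rightarrow> nat. c \<in> range h}"
    by (rule eventually_comeager_all)
  then show ?thesis
    by eventually_elim auto
qed

lemma range_comp_surj: "surj h \<Longrightarrow> range (a \<circ> h) = range a"
  by (metis image_comp)

definition seq_code :: "(nat \<Rightarrow> cantor) \<Rightarrow> cantor" where
  "seq_code b m = (case prod_decode m of (n, j) \<Rightarrow> b n j)"

lemma seq_entry_seq_code: "seq_entry (seq_code b) = b"
  by (simp add: seq_entry_def seq_code_def fun_eq_iff)

lemma pred_computable_seq_code:
  fixes A :: "'z::second_countable_topology \<Rightarrow> nat \<Rightarrow> cantor"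
  assumes f: "itt_computable_on UNIV f"
    and A: "\<And>n j. continuous_on UNIV (\<lambda>z. A z n j)" and H: "\<And>n. continuous_on UNIV (\<lambda>z. H z n)"
  shows "Measurable.pred baire_algebra (\<lambda>z. f (seq_code (A z \<circ> H z)) m)"
proof (rule category_measurable_itt_computable[OF f UNIV_I])
  fix i
  obtain n j where ij: "prod_decode i = (n, j)"
    by fastforce
  have "Measurable.pred baire_algebra (\<lambda>z. A z (H z n) j)"
    by (rule measurable_compose_countable[where f = "\<lambda>k z. A z k j"])
      (intro measurable_baire_algebra_continuous A H)+
  then show "Measurable.pred baire_algebra (\<lambda>z. seq_code (A z \<circ> H z) i)"
    by (simp add: seq_code_def ij)
qed

definition forces_value :: "(cantor \<Rightarrow> cantor) \<Rightarrow> nat list \<Rightarrow> (nat \<Rightarrow> cantor) \<Rightarrow> nat \<Rightarrow> bool \<Rightarrow> bool" where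
  "forces_value f l a m b \<longleftrightarrow> (\<forall>\<^sub>F h in comeager. h \<in> cylinder l \<longrightarrow> f (seq_code (a \<circ> h)) m = b)"

lemma pred_forces_value:
  fixes A :: "'z::second_countable_topology \<Rightarrow> nat \<Rightarrow> cantor"
  assumes f: "itt_computable_on UNIV f" and A: "\<And>n j. continuous_on UNIV (\<lambda>z. A z n j)"
  shows "Measurable.pred baire_algebra (\<lambda>z. forces_value f l (A z) m b)"
proof -
  have "continuous_on UNIV (\<lambda>p :: 'z \<times> (nat \<Rightarrow> nat). A (fst p) n j)" for n j
    by (rule continuous_on_compose2[OF A continuous_on_fst[OF continuous_on_id]]) simp
  moreover have "continuous_on UNIV (\<lambda>p :: 'z \<times> (nat \<Rightarrow> nat). snd p n)" for n
    by (rule continuous_on_product_then_coordinatewise) (rule continuous_on_snd[OF continuous_on_id])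
  ultimately have [measurable]: "Measurable.pred baire_algebra
      (\<lambda>p :: 'z \<times> (nat \<Rightarrow> nat). f (seq_code (A (fst p) \<circ> snd p)) m)"
    by (rule pred_computable_seq_code[OF f])
  have "Measurable.pred baire_algebra (\<lambda>p :: 'z \<times> (nat \<Rightarrow> nat). f (seq_code (A (fst p) \<circ> snd p)) m \<noteq> b)"
    by measurable
  from pred_baire_algebra_frequently[OF this open_cylinder[of l]]
  have "Measurable.pred baire_algebra
      (\<lambda>z. \<exists>\<^sub>F h in comeager. h \<in> cylinder l \<and> f (seq_code (A z \<circ> h)) m \<noteq> b)"
    by simp
  then have "Measurable.pred baire_algebra
      (\<lambda>z. \<not> (\<exists>\<^sub>F h in comeager. h \<in> cylinder l \<and> f (seq_code (A z \<circ> h)) m \<noteq> b))"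
    by (rule pred_intros_logic(2))
  then show ?thesis
    by (simp add: not_frequently forces_value_def)
qed

definition settled :: "(cantor \<Rightarrow> cantor) \<Rightarrow> nat list \<Rightarrow> (nat \<Rightarrow> cantor) \<Rightarrow> bool" where
  "settled f l a \<longleftrightarrow> (\<forall>m. \<exists>b. forces_value f l a m b)"

lemma pred_settled:
  assumes "itt_computable_on UNIV f"
  shows "Measurable.pred baire_algebra (settled f l)"
proof -
  have "continuous_on UNIV (\<lambda>a :: nat \<Rightarrow> cantor. a n j)" for n j
    by (rule continuous_on_product_then_coordinatewise) simp
  then have [measurable]: "Measurable.pred baire_algebra (\<lambda>a. forces_value f l a m b)" for m b
    by (rule pred_forces_value[OF assms])
  show ?thesis
    unfolding settled_def[abs_def] by measurable
qed

lemma ex_settled: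
  assumes f: "itt_computable_on UNIV f" and reduction: "\<And>x y. Eset x y \<longleftrightarrow> E0 (f x) (f y)"
  shows "\<exists>l. settled f l a"
proof -
  let ?v = "f (seq_code a)"
  have "\<forall>\<^sub>F h in comeager. \<exists>S\<in>{S. finite S}. f (seq_code (a \<circ> h)) = flip_bits S ?v"
    using eventually_comeager_surj
  proof eventually_elim
    case (elim h)
    then have "Eset (seq_code a) (seq_code (a \<circ> h))"
      unfolding Eset_def seq_entry_seq_code by (simp only: range_comp_surj)
    then show ?case
      using reduction E0_iff_flip_bits by auto
  qed
  from ex_frequently_comeager[OF this countable_Collect_finite]
  obtain S where "\<exists>\<^sub>F h in comeager. f (seq_code (a \<circ> h)) = flip_bits S ?v"
    by blast
  then have nonmeager: "\<exists>\<^sub>F h in comeager. \<forall>m. f (seq_code (a \<circ> h)) m = flip_bits S ?v m"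
    by (simp add: fun_eq_iff)
  have [measurable]: "Measurable.pred baire_algebra (\<lambda>h. f (seq_code (a \<circ> h)) m)" for m
    by (rule pred_computable_seq_code[OF f]) simp_all
  have "Measurable.pred baire_algebra (\<lambda>h. \<forall>m. f (seq_code (a \<circ> h)) m = flip_bits S ?v m)"
    by measurable
  then obtain U where U: "open U" "U \<noteq> {}"
    "\<forall>\<^sub>F h in comeager. h \<in> U \<longrightarrow> (\<forall>m. f (seq_code (a \<circ> h)) m = flip_bits S ?v m)"
    using frequently_comeager_imp_localized nonmeager by blast
  obtain l where "cylinder l \<subseteq> U"
    using ex_cylinder_subset_open[OF U(1,2)] by blast
  then have "forces_value f l a m (flip_bits S ?v m)" for m
    using U(3) unfolding forces_value_def by (auto elim!: eventually_mono)
  then show ?thesis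
    unfolding settled_def by blast
qed

subsection \<open>Splitting and permuting sequences\<close>

definition prepend :: "nat \<Rightarrow> (nat \<Rightarrow> 'a) \<Rightarrow> (nat \<Rightarrow> 'a) \<Rightarrow> nat \<Rightarrow> 'a" where
  "prepend d c a i = (if i < d then c i else a (i - d))"

lemma prepend_shift: "prepend d x (\<lambda>i. x (i + d)) = x"
  by (simp add: prepend_def fun_eq_iff)

lemma continuous_on_prepend:
  "continuous_on UNIV (\<lambda>p. prepend d (fst p) (snd p) :: nat \<Rightarrow> 'a::topological_space)"
proof (rule continuous_on_coordinatewise_then_product)
  show "continuous_on UNIV (\<lambda>p :: (nat \<Rightarrow> 'a) \<times> (nat \<Rightarrow> 'a). prepend d (fst p) (snd p) i)" for i
    unfolding prepend_def
    by (cases "i < d")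
      (simp_all add: continuous_on_product_then_coordinatewise continuous_on_fst continuous_on_snd)
qed

lemma filterlim_comeager_prepend:
  "filterlim (\<lambda>p. prepend d (fst p) (snd p) :: nat \<Rightarrow> 'a::topological_space) comeager comeager"
proof -
  define split_off where "split_off c x = (prepend d x (\<lambda>i. c (i + d)), \<lambda>i. x (i + d))" for c x :: "nat \<Rightarrow> 'a"
  show ?thesis
  proof (rule filterlim_comeager_local_sections[OF continuous_on_prepend])
    show "continuous_on UNIV (split_off c)" for c
      unfolding split_off_def
    proof (intro continuous_on_Pair continuous_on_coordinatewise_then_product)
      show "continuous_on UNIV (\<lambda>x :: nat \<Rightarrow> 'a. prepend d x (\<lambda>i. c (i + d)) i)" for i
        by (cases "i < d") (simp_all add: prepend_def)
    qed simp
    show "prepend d (fst (split_off c x)) (snd (split_off c x)) = x" for c x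
      by (simp add: split_off_def prepend_def fun_eq_iff)
    have "split_off (fst p) (prepend d (fst p) (snd p)) = p" for p
      by (simp add: split_off_def prepend_def fun_eq_iff prod_eq_iff)
    then show "\<exists>c. split_off c (prepend d (fst p) (snd p)) = p" for p
      by blast
  qed
qed

lemma filterlim_comeager_coordinate:
  "filterlim (\<lambda>a. a k :: 'a::topological_space) comeager comeager"
proof (rule filterlim_comeager_local_sections[where \<sigma> = "\<lambda>a u. a(k := u)"])
  show "continuous_on UNIV (\<lambda>u. a(k := u))" for a :: "'b \<Rightarrow> 'a"
  proof (rule continuous_on_coordinatewise_then_product)
    show "continuous_on UNIV (\<lambda>u. (a(k := u)) i)" for i
      by (cases "i = k") simp_all
  qed
  show "\<exists>a'. a'(k := a k) = a" for a :: "'b \<Rightarrow> 'a"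
    by (rule exI[of _ a]) simp
qed simp_all

definition block_swap :: "nat \<Rightarrow> nat \<Rightarrow> nat" where
  "block_swap n i = (if i < n then i + n else if i < 2 * n then i - n else i)"

lemma block_swap_involution: "block_swap n (block_swap n i) = i"
  by (auto simp: block_swap_def)

lemma finite_block_swap: "finite {i. block_swap n i \<noteq> i}"
  by (rule finite_subset[of _ "{..<2 * n}"]) (auto simp: block_swap_def)

lemma continuous_on_comp: "continuous_on UNIV (\<lambda>a. a \<circ> \<pi> :: nat \<Rightarrow> 'a::topological_space)"
  by (rule continuous_on_coordinatewise_then_product) simp

lemma eventually_comeager_block_swap_orbit:
  fixes U :: "(nat \<Rightarrow> 'a::topological_space) set"
  assumes "open U" "U \<noteq> {}"
  shows "\<forall>\<^sub>F a in comeager. \<exists>n. a \<circ> block_swap n \<in> U"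
proof -
  have "\<forall>\<^sub>F a in comeager. a \<in> (\<Union>n. (\<lambda>a. a \<circ> block_swap n) -` U)"
  proof (rule eventually_comeager_open_dense)
    show "open (\<Union>n. (\<lambda>a. a \<circ> block_swap n) -` U)"
      by (intro open_UN ballI open_vimage[OF assms(1)] continuous_on_comp)
    fix W :: "(nat \<Rightarrow> 'a) set" assume "open W" "W \<noteq> {}"
    then obtain l where l: "cylinder l \<subseteq> W"
      using ex_cylinder_subset_open by blast
    obtain k where k: "cylinder k \<subseteq> U"
      using ex_cylinder_subset_open[OF assms] by blast
    define n where "n = max (length l) (length k)"
    define a where "a i = (if i < n then l ! i else k ! (i - n))" for i
    have "a \<in> cylinder l" "a \<circ> block_swap n \<in> cylinder k"
      by (auto simp: cylinder_def a_def n_def block_swap_def)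
    then show "\<exists>a\<in>W. a \<in> (\<Union>n. (\<lambda>a. a \<circ> block_swap n) -` U)"
      using l k by blast
  qed
  then show ?thesis
    by eventually_elim simp
qed

text \<open>The category analogue of the Hewitt-Savage zero-one law.\<close>

lemma exchangeable_zero_one_law:
  fixes Q :: "(nat \<Rightarrow> 'a::topological_space) \<Rightarrow> bool"
  assumes "Measurable.pred baire_algebra Q"
    and exchangeable: "\<And>\<pi> a. (\<And>i. \<pi> (\<pi> i) = i) \<Longrightarrow> finite {i. \<pi> i \<noteq> i} \<Longrightarrow> Q (a \<circ> \<pi>) \<Longrightarrow> Q a"
  shows "(\<forall>\<^sub>F a in comeager. Q a) \<or> (\<forall>\<^sub>F a in comeager. \<not> Q a)"
proof (rule topological_zero_one_law[where \<Gamma> = "range (\<lambda>n a. a \<circ> block_swap n)", OF _ _ _ assms(1)])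
  have "filterlim (\<lambda>a :: nat \<Rightarrow> 'a. a \<circ> block_swap n) comeager comeager" for n
    by (rule filterlim_comeager_involution[OF continuous_on_comp])
      (simp add: fun_eq_iff block_swap_involution)
  then show "filterlim \<gamma> comeager comeager" if "\<gamma> \<in> range (\<lambda>n a. a \<circ> block_swap n)"
    for \<gamma> :: "(nat \<Rightarrow> 'a) \<Rightarrow> _"
    using that by (elim rangeE) simp
  show "\<forall>\<^sub>F a in comeager. \<exists>\<gamma>\<in>range (\<lambda>n a. a \<circ> block_swap n). \<gamma> a \<in> U"
    if "open U" "U \<noteq> {}" for U :: "(nat \<Rightarrow> 'a) set"
    using eventually_comeager_block_swap_orbit[OF that] by simp
  show "Q a" if \<gamma>: "\<gamma> \<in> range (\<lambda>n a. a \<circ> block_swap n)" and "Q (\<gamma> a)" for \<gamma> a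
  proof -
    obtain n where "\<gamma> = (\<lambda>a. a \<circ> block_swap n)"
      using \<gamma> by (rule rangeE)
    then show ?thesis
      using exchangeable[OF block_swap_involution finite_block_swap, of a n] \<open>Q (\<gamma> a)\<close> by simp
  qed
qed simp

subsection \<open>\<open>Eset\<close> and \<open>E0\<close>\<close>

context
  fixes f :: "cantor \<Rightarrow> cantor"
  assumes computable: "itt_computable_on UNIV f" and reduction: "\<And>x y. Eset x y \<longleftrightarrow> E0 (f x) (f y)"
begin

lemma ex_frequently_settled:
  obtains l d c where "\<And>i. i \<in> set l \<Longrightarrow> i < d" "\<exists>\<^sub>F a in comeager. settled f l (prepend d c a)"
proof -
  have "\<forall>\<^sub>F a in comeager. \<exists>l\<in>UNIV. settled f l a"
    using ex_settled[OF computable reduction] by simp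
  from ex_frequently_comeager[OF this] obtain l where "\<exists>\<^sub>F a in comeager. settled f l a"
    by auto
  then obtain U where U: "open U" "U \<noteq> {}" "\<forall>\<^sub>F a in comeager. a \<in> U \<longrightarrow> settled f l a"
    using frequently_comeager_imp_localized[OF pred_settled[OF computable]] by blast
  define d where "d = Suc (Max (insert 0 (set l)))"
  have d: "i < d" if "i \<in> set l" for i
    unfolding d_def using that by (auto intro!: le_imp_less_Suc Max_ge)
  define glue where "glue p = prepend d (fst p) (snd p)" for p :: "(nat \<Rightarrow> cantor) \<times> (nat \<Rightarrow> cantor)"
  obtain x where "x \<in> U"
    using U(2) by blast
  then have "(x, \<lambda>i. x (i + d)) \<in> glue -` U"
    by (simp add: glue_def prepend_shift)
  then have "glue -` U \<noteq> {}"
    by blast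
  moreover have "open (glue -` U)"
    unfolding glue_def by (rule open_vimage[OF U(1) continuous_on_prepend])
  moreover have "\<forall>\<^sub>F p in comeager. p \<in> glue -` U \<longrightarrow> settled f l (glue p)"
    using eventually_compose_filterlim[OF U(3) filterlim_comeager_prepend[of d]] by (simp add: glue_def)
  ultimately obtain c where "\<exists>\<^sub>F a in comeager. settled f l (glue (c, a))"
    using ex_frequently_section[of "glue -` U" "\<lambda>p. settled f l (glue p)"] by metis
  then show thesis
    using that[of l d c] d by (simp add: glue_def)
qed

lemma forces_value_exchangeable:
  assumes "\<And>i. i \<in> set l \<Longrightarrow> i < d" and involution: "\<And>i. \<pi> (\<pi> i) = i"
    and forced: "forces_value f l (prepend d c (a \<circ> \<pi>)) m b"
  shows "forces_value f l (prepend d c a) m b"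
proof -
  define \<sigma> where "\<sigma> i = (if i < d then i else \<pi> (i - d) + d)" for i
  have \<sigma>: "\<sigma> (\<sigma> i) = i" for i
    using involution by (simp add: \<sigma>_def)
  have "filterlim (\<lambda>h :: nat \<Rightarrow> nat. \<sigma> \<circ> h) comeager comeager"
  proof (rule filterlim_comeager_involution)
    show "continuous_on UNIV (\<lambda>h :: nat \<Rightarrow> nat. \<sigma> \<circ> h)"
    proof (rule continuous_on_coordinatewise_then_product)
      show "continuous_on UNIV (\<lambda>h :: nat \<Rightarrow> nat. (\<sigma> \<circ> h) i)" for i
        by (simp, rule continuous_on_compose2[of UNIV \<sigma>]) simp_all
    qed
  qed (simp add: fun_eq_iff \<sigma>)
  then have "\<forall>\<^sub>F h in comeager. \<sigma> \<circ> h \<in> cylinder l \<longrightarrow> f (seq_code (prepend d c (a \<circ> \<pi>) \<circ> (\<sigma> \<circ> h))) m = b"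
    by (rule eventually_compose_filterlim[OF forced[unfolded forces_value_def]])
  moreover have "prepend d c (a \<circ> \<pi>) \<circ> (\<sigma> \<circ> h) = prepend d c a \<circ> h" for h :: "nat \<Rightarrow> nat"
    using involution by (auto simp: prepend_def \<sigma>_def fun_eq_iff)
  moreover have "\<sigma> \<circ> h \<in> cylinder l \<longleftrightarrow> h \<in> cylinder l" for h
  proof -
    have "\<sigma> (l ! i) = l ! i" if "i < length l" for i
      using assms(1)[OF nth_mem[OF that]] by (simp add: \<sigma>_def)
    then have "\<sigma> (h i) = l ! i \<longleftrightarrow> h i = l ! i" if "i < length l" for i
      using \<sigma> that by metis
    then show ?thesis
      by (simp add: cylinder_def)
  qed
  ultimately show ?thesis
    by (simp add: forces_value_def)
qed

lemma ex_generic_bit: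
  assumes l: "\<And>i. i \<in> set l \<Longrightarrow> i < d"
    and settled: "\<exists>\<^sub>F a in comeager. settled f l (prepend d c a)"
  shows "\<exists>b. \<forall>\<^sub>F a in comeager. forces_value f l (prepend d c a) m b"
proof -
  have "\<exists>\<^sub>F a in comeager. \<exists>b. forces_value f l (prepend d c a) m b"
    using settled by (rule frequently_elim1) (simp add: settled_def)
  then obtain b where b: "\<exists>\<^sub>F a in comeager. forces_value f l (prepend d c a) m b"
    unfolding ex_bool_eq frequently_disj_iff by blast
  have "continuous_on UNIV (\<lambda>a :: nat \<Rightarrow> cantor. prepend d c a n j)" for n j
    by (cases "n < d")
      (simp_all add: prepend_def
        continuous_on_product_then_coordinatewise[OF continuous_on_product_coordinates])
  then have "Measurable.pred baire_algebra (\<lambda>a. forces_value f l (prepend d c a) m b)"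
    by (rule pred_forces_value[OF computable])
  then have "(\<forall>\<^sub>F a in comeager. forces_value f l (prepend d c a) m b) \<or>
      (\<forall>\<^sub>F a in comeager. \<not> forces_value f l (prepend d c a) m b)"
    using forces_value_exchangeable[OF l] by (rule exchangeable_zero_one_law)
  then show ?thesis
    using b by (auto simp: frequently_def)
qed

lemma ex_generic_value:
  obtains l d c v where "\<forall>\<^sub>F a in comeager. \<forall>\<^sub>F h in comeager.
    h \<in> cylinder l \<longrightarrow> f (seq_code (prepend d c a \<circ> h)) = v"
proof -
  obtain l d c where l: "\<And>i. i \<in> set l \<Longrightarrow> i < d"
    and settled: "\<exists>\<^sub>F a in comeager. settled f l (prepend d c a)"
    by (rule ex_frequently_settled) blast
  have "\<forall>m. \<exists>b. \<forall>\<^sub>F a in comeager. forces_value f l (prepend d c a) m b"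
    using ex_generic_bit[OF l settled] by blast
  from choice[OF this] obtain v
    where "\<forall>m. \<forall>\<^sub>F a in comeager. forces_value f l (prepend d c a) m (v m)" ..
  then have "\<forall>\<^sub>F a in comeager. \<forall>m. forces_value f l (prepend d c a) m (v m)"
    by (intro eventually_comeager_all) simp
  then have "\<forall>\<^sub>F a in comeager. \<forall>\<^sub>F h in comeager.
      h \<in> cylinder l \<longrightarrow> f (seq_code (prepend d c a \<circ> h)) = v"
  proof eventually_elim
    case (elim a)
    then have "\<forall>\<^sub>F h in comeager.
        \<forall>m. h \<in> cylinder l \<longrightarrow> f (seq_code (prepend d c a \<circ> h)) m = v m"
      by (intro eventually_comeager_all) (simp add: forces_value_def)
    then show ?case
      by eventually_elim (simp add: fun_eq_iff)
  qed
  then show thesis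
    by (rule that)
qed

lemma range_eq_of_same_value:
  assumes "f (seq_code (a \<circ> h)) = f (seq_code (a' \<circ> h'))" "surj h" "surj h'"
  shows "range a = range a'"
proof -
  have "Eset (seq_code (a \<circ> h)) (seq_code (a' \<circ> h'))"
    using assms(1) by (simp add: reduction E0_refl)
  then show ?thesis
    unfolding Eset_def seq_entry_seq_code range_comp_surj[OF assms(2)] range_comp_surj[OF assms(3)] .
qed

end

theorem Eset_not_reducible_to_E0: "\<not> itt_reducible Eset UNIV E0 UNIV"
proof
  assume "itt_reducible Eset UNIV E0 UNIV"
  then obtain f where f: "itt_computable_on UNIV f" "\<And>x y. Eset x y \<longleftrightarrow> E0 (f x) (f y)"
    unfolding itt_reducible_def by auto
  obtain l d c v where v: "\<forall>\<^sub>F a in comeager. \<forall>\<^sub>F h in comeager.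
      h \<in> cylinder l \<longrightarrow> f (seq_code (prepend d c a \<circ> h)) = v"
    using ex_generic_value[OF f] by blast
  have attained: "\<forall>\<^sub>F a in comeager. \<exists>h. surj h \<and> f (seq_code (prepend d c a \<circ> h)) = v"
    using v
  proof eventually_elim
    case (elim a)
    have "\<exists>\<^sub>F h in comeager. h \<in> cylinder l"
      by (rule frequently_comeager_open[OF open_cylinder cylinder_nonempty])
    from frequently_eventually_frequently[OF this eventually_conj[OF elim eventually_comeager_surj]]
    show ?case
      by (auto dest: frequently_ex)
  qed
  then obtain a h where a: "surj h" "f (seq_code (prepend d c a \<circ> h)) = v"
    using eventually_happens'[OF comeager_neq_bot] by blast
  have "\<forall>\<^sub>F a' in comeager. a' 0 \<noteq> x" for x :: cantor
    by (rule eventually_compose_filterlim[OF eventually_comeager_neq filterlim_comeager_coordinate])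
  then have "\<forall>\<^sub>F a' in comeager. \<forall>x\<in>range (prepend d c a). a' 0 \<noteq> x"
    by (intro eventually_comeager_ball) auto
  then obtain a' h' where a': "surj h'" "f (seq_code (prepend d c a' \<circ> h')) = v"
    "\<forall>x\<in>range (prepend d c a). a' 0 \<noteq> x"
    using eventually_happens'[OF comeager_neq_bot eventually_conj[OF attained]] by blast
  have "range (prepend d c a) = range (prepend d c a')"
    using a a'(1,2) by (intro range_eq_of_same_value[OF f, of _ h _ h']) simp_all
  moreover have "a' 0 = prepend d c a' d"
    by (simp add: prepend_def)
  ultimately show False
    using a'(3) by blast
qed

theorem mainTheorem8:
  shows "\<not> itt_reducible E0 UNIV (=) UNIV \<and>
         \<not> itt_reducible Eset UNIV E0 UNIV \<and>
         \<not> itt_reducible iso_HC HC iso_WO WO \<and>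
         \<not> itt_reducible Eset UNIV iso_WO WO"
  by (intro conjI E0_not_reducible_to_equality Eset_not_reducible_to_E0
      iso_HC_not_reducible_to_iso_WO Eset_not_reducible_to_iso_WO)

end
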